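(* Let $m=(m_0,\dots,m_s)$ be a vector of odd integers $\ge3$, $G=\bigoplus_{\ell=0}^s\mathbb Z_{m_\ell}$. Then for each $k\in G$ the family $\{\pi(k,\kappa)\psi:\kappa\in G\}$ (index set $\beta_k=\{(k,\kappa):\kappa\in G\}$) is a simplex of the Gabor–Steiner equiangular tight frame $\mathcal G(m)$, and moreover $\mathcal G(m)$ is a Steiner equiangular tight frame: there exist a $(|m|,2,1)$-BIBD with point set $G$, an identification of its $|m|(|m|-1)/2$ blocks with the coordinates of $\mathbb C^{|m|(|m|-1)/2}$, and for each point $x\in G$ a matrix $\tilde F_x$ obtained from $F_m$ by deleting one row and multiplying the remaining rows by unimodular scalars, such that the Steiner construction below produces exactly the vectors $\pi(x,\kappa)\psi$, $(x,\kappa)\in G\times G$ (the column of $\Phi_x$ indexed by $\kappa$ being $\pi(x,\kappa)\psi$).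
   Context: Notation: $|m|=\prod_\ell m_\ell$; elements of $G$ are ordered lexicographically and $\mathbb C^{|m|}$ has standard basis $\{e_j\}_{j\in G}$. Fix primitive $m_\ell$-th roots of unity $\zeta_{m_\ell}$. $T_m^{(k)}e_j=e_{j+k}$ and $M_m^{(\kappa)}e_j=\prod_\ell\zeta_{m_\ell}^{\kappa_\ell j_\ell}e_j$ (these are the Kronecker products of powers of the cyclic shifts and of $\mathrm{diag}(1,\zeta_{m_\ell},\dots,\zeta_{m_\ell}^{m_\ell-1})$). $F_m=(\prod_\ell\zeta_{m_\ell}^{i_\ell j_\ell})_{i,j\in G}$. Let $c=((m_0-1)/2,\dots,(m_s-1)/2)$ and $\mathcal I=\{i\in G: i<_{\mathrm{lex}}c\}$ ($(|m|-1)/2$ elements). For $i\in\mathcal I$ let $\phi_i=e_i-e_{-i-\mathbb 1}\in\mathbb R^{|m|}$, where $-i-\mathbb 1=(m_0-i_0-1,\dots,m_s-i_s-1)$. Let $\psi\in\mathbb R^{|m|(|m|-1)/2}$ be the concatenation of $\phi_i$, $i\in\mathcal I$, in lexicographic order, and $\pi(k,\kappa)=I_{(|m|-1)/2}\otimes(M_m^{(\kappa)}T_m^{(k)})$. The Gabor–Steiner ETF is $\mathcal G(m)=\{\pi(k,\kappa)\psi\}_{(k,\kappa)\in G\times G}$. An equiangular tight frame (ETF) for a space is a spanning family of equal-norm vectors with $|\langle\varphi_j,\varphi_l\rangle|$ constant for $j\ne l$ and $\sum_j\varphi_j\varphi_j^*$ a multiple of the identity. Families $\Phi,\Psi$ are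 switching equivalent if $\Psi=U\Phi PD$ with $U$ unitary, $P$ a permutation and $D$ a unimodular diagonal matrix. A subfamily $\{\varphi_j\}_{j\in\beta}$ of an ETF is a simplex if it is switching equivalent to an ETF for a space of dimension $|\beta|-1$ all of whose pairwise inner products are real and negative. Steiner construction: given a $(v,k,1)$-BIBD with $b=v(v-1)/(k(k-1))$ blocks and for each point $x$ a matrix $\tilde F_x$ with $(v-1)/(k-1)$ rows (obtained from a Fourier matrix of a group of order $(k+v-2)/(k-1)$ by deleting one row and rescaling rows by unimodulars), let $\Phi_x$ be the $b\times\frac{k+v-2}{k-1}$ matrix whose row for each block containing $x$ is a distinct row of $\tilde F_x$ and whose other rows are zero; the columns of $(\Phi_x)_x$ form a Steiner ETF. A $(v,k,\lambda)$-BIBD is a collection of $k$-subsets of a $v$-set with every pair of distinct points in exactly $\lambda$ blocks. *)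

theory Defs
  imports
    "Jordan_Normal_Form.VS_Connect"
    "Jordan_Normal_Form.Schur_Decomposition"
    "HOL-Combinatorics.Permutations"
    "HOL-Library.List_Lexorder"
begin

section \<open>Frames\<close>

text \<open>Families of vectors of \<open>\<complex>\<^sup>N\<close> are functions on an arbitrary finite index set \<open>J\<close>, with values in
  \<open>carrier_vec N\<close>. A space is a linear subspace of \<open>\<complex>\<^sup>N\<close>.\<close>

abbreviation cspan :: "nat \<Rightarrow> complex vec set \<Rightarrow> complex vec set" where
  "cspan N S \<equiv> LinearCombinations.module.span class_ring (module_vec TYPE(complex) N) S"

abbreviation cdim :: "nat \<Rightarrow> complex vec set \<Rightarrow> nat" where
  "cdim N W \<equiv> vectorspace.dim class_ring ((module_vec TYPE(complex) N)\<lparr>carrier := W\<rparr>)"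

text \<open>The matrix \<open>\<Sum>\<^sub>j \<phi>\<^sub>j \<phi>\<^sub>j\<^sup>*\<close>.\<close>

definition frame_operator :: "nat \<Rightarrow> 'j set \<Rightarrow> ('j \<Rightarrow> complex vec) \<Rightarrow> complex mat" where
  "frame_operator N J \<phi> = mat N N (\<lambda>(a, b). \<Sum>j\<in>J. \<phi> j $ a * cnj (\<phi> j $ b))"

definition etf_for :: "nat \<Rightarrow> complex vec set \<Rightarrow> 'j set \<Rightarrow> ('j \<Rightarrow> complex vec) \<Rightarrow> bool" where
  "etf_for N W J \<phi> \<longleftrightarrow>
     finite J \<and> \<phi> ` J \<subseteq> carrier_vec N \<and> cspan N (\<phi> ` J) = W \<and>
     (\<exists>r. \<forall>j\<in>J. \<phi> j \<bullet>c \<phi> j = r) \<and>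
     (\<exists>\<alpha>. \<forall>j\<in>J. \<forall>l\<in>J. j \<noteq> l \<longrightarrow> cmod (\<phi> j \<bullet>c \<phi> l) = \<alpha>) \<and>
     (\<exists>A. \<forall>w\<in>W. frame_operator N J \<phi> *\<^sub>v w = A \<cdot>\<^sub>v w)"

definition unitary_mat :: "nat \<Rightarrow> complex mat \<Rightarrow> bool" where
  "unitary_mat N U \<longleftrightarrow>
     U \<in> carrier_mat N N \<and> mat_adjoint U * U = 1\<^sub>m N \<and> U * mat_adjoint U = 1\<^sub>m N"

text \<open>The relation \<open>\<Psi> = U \<Phi> P D\<close>, written column by column: \<open>\<sigma>\<close> is the permutation given by \<open>P\<close>, and
  \<open>d\<close> is the diagonal of \<open>D\<close>.\<close>

definition switching_equivalent ::
    "nat \<Rightarrow> 'j set \<Rightarrow> ('j \<Rightarrow> complex vec) \<Rightarrow> ('j \<Rightarrow> complex vec) \<Rightarrow> bool" where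
  "switching_equivalent N J \<phi> \<psi> \<longleftrightarrow>
     (\<exists>U \<sigma> d. unitary_mat N U \<and> \<sigma> permutes J \<and> (\<forall>j\<in>J. cmod (d j) = 1) \<and>
        (\<forall>j\<in>J. \<psi> j = d j \<cdot>\<^sub>v (U *\<^sub>v \<phi> (\<sigma> j))))"

text \<open>\<open>is_simplex N V J \<phi> \<beta>\<close>: \<open>\<phi>\<close> (indexed by \<open>J\<close>) is an ETF for \<open>V\<close>, and its subfamily indexed by
  \<open>\<beta>\<close> is a simplex.\<close>

definition is_simplex ::
    "nat \<Rightarrow> complex vec set \<Rightarrow> 'j set \<Rightarrow> ('j \<Rightarrow> complex vec) \<Rightarrow> 'j set \<Rightarrow> bool" where
  "is_simplex N V J \<phi> \<beta> \<longleftrightarrow>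
     etf_for N V J \<phi> \<and> \<beta> \<subseteq> J \<and>
     (\<exists>\<psi> W. switching_equivalent N \<beta> \<phi> \<psi> \<and> etf_for N W \<beta> \<psi> \<and> cdim N W + 1 = card \<beta> \<and>
        (\<forall>j\<in>\<beta>. \<forall>l\<in>\<beta>. j \<noteq> l \<longrightarrow> \<psi> j \<bullet>c \<psi> l \<in> \<real> \<and> Re (\<psi> j \<bullet>c \<psi> l) < 0))"

section \<open>Block designs and the Steiner construction\<close>

text \<open>The blocks form a set; for \<open>\<lambda> = 1\<close> and \<open>k \<ge> 2\<close>, the case needed here, a block cannot be repeated.\<close>

definition is_bibd :: "'p set \<Rightarrow> 'p set set \<Rightarrow> nat \<Rightarrow> nat \<Rightarrow> nat \<Rightarrow> bool" where
  "is_bibd X \<B> v k l \<longleftrightarrow>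
     finite X \<and> card X = v \<and> (\<forall>B\<in>\<B>. B \<subseteq> X \<and> card B = k) \<and>
     (\<forall>x\<in>X. \<forall>y\<in>X. x \<noteq> y \<longrightarrow> card {B\<in>\<B>. x \<in> B \<and> y \<in> B} = l)"

text \<open>\<open>insert_index r\<close> is the increasing enumeration of the indices different from \<open>r\<close>.\<close>

definition row_deleted_rescaled :: "complex mat \<Rightarrow> complex mat \<Rightarrow> bool" where
  "row_deleted_rescaled F F' \<longleftrightarrow>
     (\<exists>r u. r < dim_row F \<and> (\<forall>a. cmod (u a) = 1) \<and>
        F' = mat (dim_row F - 1) (dim_col F) (\<lambda>(a, b). u a * F $$ (insert_index r a, b)))"

text \<open>\<open>blk a\<close> is the block labelling coordinate \<open>a < N\<close>. The rows of \<open>\<Phi>\<close> at the blocks containing \<open>x\<close>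
  are the rows of \<open>F'\<close>, each used once; the other rows vanish.\<close>

definition steiner_submatrix ::
    "nat \<Rightarrow> (nat \<Rightarrow> 'p set) \<Rightarrow> 'p \<Rightarrow> complex mat \<Rightarrow> complex mat \<Rightarrow> bool" where
  "steiner_submatrix N blk x F' \<Phi> \<longleftrightarrow>
     \<Phi> \<in> carrier_mat N (dim_col F') \<and>
     (\<exists>\<rho>. bij_betw \<rho> {a. a < N \<and> x \<in> blk a} {..<dim_row F'} \<and>
        (\<forall>a<N. row \<Phi> a = (if x \<in> blk a then row F' (\<rho> a) else 0\<^sub>v (dim_col F'))))"

section \<open>The Gabor--Steiner frame\<close>

text \<open>An element of \<open>G = \<Oplus>\<^sub>l \<int>\<^bsub>m\<^sub>l\<^esub>\<close> is the list of the representatives of its components in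
  \<open>{0..<m\<^sub>l}\<close>. The order on lists is the lexicographic one of \<^theory>\<open>HOL-Library.List_Lexorder\<close>.\<close>

definition G_elems :: "nat list \<Rightarrow> nat list set" where
  "G_elems m = {j. length j = length m \<and> (\<forall>l<length m. j ! l < m ! l)}"

definition G_list :: "nat list \<Rightarrow> nat list list" where
  "G_list m = sorted_list_of_set (G_elems m)"

definition G_add :: "nat list \<Rightarrow> nat list \<Rightarrow> nat list \<Rightarrow> nat list" where
  "G_add m i j = map (\<lambda>l. (i ! l + j ! l) mod m ! l) [0..<length m]"

text \<open>The map \<open>i \<mapsto> -i - \<one>\<close>.\<close>

definition G_reflect :: "nat list \<Rightarrow> nat list \<Rightarrow> nat list" where
  "G_reflect m i = map (\<lambda>l. m ! l - i ! l - 1) [0..<length m]"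

definition I_elems :: "nat list \<Rightarrow> nat list set" where
  "I_elems m = {i \<in> G_elems m. i < map (\<lambda>n. (n - 1) div 2) m}"

definition primitive_root_of_unity :: "nat \<Rightarrow> complex \<Rightarrow> bool" where
  "primitive_root_of_unity n z \<longleftrightarrow> z ^ n = 1 \<and> (\<forall>d. 0 < d \<and> d < n \<longrightarrow> z ^ d \<noteq> 1)"

text \<open>\<open>\<zeta> l\<close> is the chosen primitive root of unity of order \<open>m ! l\<close>.\<close>

definition G_char :: "nat list \<Rightarrow> (nat \<Rightarrow> complex) \<Rightarrow> nat list \<Rightarrow> nat list \<Rightarrow> complex" where
  "G_char m \<zeta> i j = (\<Prod>l<length m. \<zeta> l ^ (i ! l * j ! l))"

definition basis_vec :: "nat list \<Rightarrow> nat list \<Rightarrow> complex vec" where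
  "basis_vec m j = vec (prod_list m) (\<lambda>a. if G_list m ! a = j then 1 else 0)"

definition translation_mat :: "nat list \<Rightarrow> nat list \<Rightarrow> complex mat" where
  "translation_mat m k =
     mat_of_cols (prod_list m) (map (\<lambda>j. basis_vec m (G_add m j k)) (G_list m))"

definition modulation_mat :: "nat list \<Rightarrow> (nat \<Rightarrow> complex) \<Rightarrow> nat list \<Rightarrow> complex mat" where
  "modulation_mat m \<zeta> \<kappa> =
     mat_of_cols (prod_list m) (map (\<lambda>j. G_char m \<zeta> \<kappa> j \<cdot>\<^sub>v basis_vec m j) (G_list m))"

definition fourier_mat :: "nat list \<Rightarrow> (nat \<Rightarrow> complex) \<Rightarrow> complex mat" where
  "fourier_mat m \<zeta> =
     mat (prod_list m) (prod_list m) (\<lambda>(a, b). G_char m \<zeta> (G_list m ! a) (G_list m ! b))"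

definition phi_vec :: "nat list \<Rightarrow> nat list \<Rightarrow> complex vec" where
  "phi_vec m i = basis_vec m i - basis_vec m (G_reflect m i)"

definition psi_vec :: "nat list \<Rightarrow> complex vec" where
  "psi_vec m = vec_of_list
     (concat (map (\<lambda>i. list_of_vec (phi_vec m i)) (sorted_list_of_set (I_elems m))))"

definition kronecker :: "complex mat \<Rightarrow> complex mat \<Rightarrow> complex mat" where
  "kronecker A B = mat (dim_row A * dim_row B) (dim_col A * dim_col B)
     (\<lambda>(a, b). A $$ (a div dim_row B, b div dim_col B) * B $$ (a mod dim_row B, b mod dim_col B))"

definition pi_mat :: "nat list \<Rightarrow> (nat \<Rightarrow> complex) \<Rightarrow> nat list \<times> nat list \<Rightarrow> complex mat" where
  "pi_mat m \<zeta> = (\<lambda>(k, \<kappa>).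
     kronecker (1\<^sub>m ((prod_list m - 1) div 2)) (modulation_mat m \<zeta> \<kappa> * translation_mat m k))"

definition gabor_steiner ::
    "nat list \<Rightarrow> (nat \<Rightarrow> complex) \<Rightarrow> nat list \<times> nat list \<Rightarrow> complex vec" where
  "gabor_steiner m \<zeta> p = pi_mat m \<zeta> p *\<^sub>v psi_vec m"

end

theory Submission
  imports Defs "Jordan_Normal_Form.DL_Rank" "HOL-Number_Theory.Cong"
begin

text \<open>
  The coordinate of \<open>\<complex>\<^sup>N\<close> labelled by \<open>i \<in> \<I>\<close> and \<open>g \<in> G\<close> of \<open>\<pi>(k, \<kappa>)\<psi>\<close> is \<open>\<chi>\<^sub>\<kappa>(g)\<close> times a sign, which is \<open>1\<close> if
  \<open>g = i + k\<close>, \<open>-1\<close> if \<open>g = -i - \<one> + k\<close> and \<open>0\<close> otherwise. So the coordinate \<open>(i, g)\<close> only sees the two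
  points \<open>k\<close> with \<open>g - k \<in> {i, -i - \<one>}\<close>, and these pairs are the blocks. Since \<open>2\<close> is invertible in \<open>G\<close>,
  two distinct points \<open>x, y\<close> determine \<open>j\<close> with \<open>j + x = -j - \<one> + y\<close>, hence lie in exactly one block. For a
  fixed \<open>k\<close> the nonzero coordinates run once through all \<open>g \<noteq> c + k\<close>, so the columns are those of the Fourier
  matrix without the row \<open>c + k\<close>, up to the signs of the rows. By orthogonality of characters the Gram matrix for
  fixed \<open>k\<close> is \<open>n I - u u\<^sup>*\<close> with \<open>u\<close> unimodular, which is switching equivalent to
  \<open>n I\<close> minus the all-ones matrix; for \<open>k \<noteq> l\<close>
  the two vectors share a single nonzero coordinate, so their inner product is unimodular.
\<close>

section \<open>Componentwise arithmetic in \<open>G\<close>\<close>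

lemma G_elems_Nil [simp]: "G_elems [] = {[]}"
  by (auto simp: G_elems_def)

lemma G_elems_Cons: "G_elems (a # m) = (\<lambda>(x, xs). x # xs) ` ({..<a} \<times> G_elems m)"
proof (rule Set.set_eqI)
  fix j
  show "j \<in> G_elems (a # m) \<longleftrightarrow> j \<in> (\<lambda>(x, xs). x # xs) ` ({..<a} \<times> G_elems m)"
    by (cases j) (auto simp: G_elems_def All_less_Suc2 image_iff)
qed

lemma inj_Cons_pair: "inj_on (\<lambda>(x, xs). x # xs) A"
  by (auto simp: inj_on_def)

lemma finite_G_elems [simp]: "finite (G_elems m)"
  by (induction m) (auto simp: G_elems_Cons)

lemma card_G_elems: "card (G_elems m) = prod_list m"
  by (induction m) (auto simp: G_elems_Cons card_image inj_Cons_pair)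

text \<open>Distributivity over a product set, by induction on the number of components. It later
  splits a character sum over the group into one geometric sum per component.\<close>

lemma sum_prod_G_elems:
  fixes f :: "nat \<Rightarrow> nat \<Rightarrow> 'a :: comm_semiring_1"
  shows "(\<Sum>j\<in>G_elems m. \<Prod>l<length m. f l (j ! l)) = (\<Prod>l<length m. \<Sum>x<m ! l. f l x)"
proof (induction m arbitrary: f)
  case (Cons a m)
  have "(\<Sum>j\<in>G_elems (a # m). \<Prod>l<length (a # m). f l (j ! l)) =
      (\<Sum>(x, xs)\<in>{..<a} \<times> G_elems m. f 0 x * (\<Prod>l<length m. f (Suc l) (xs ! l)))"
    unfolding G_elems_Cons
    by (subst sum.reindex[OF inj_Cons_pair])
      (auto simp: prod.lessThan_Suc_shift simp del: prod.lessThan_Suc intro!: sum.cong)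
  also have "\<dots> = (\<Sum>x<a. f 0 x) * (\<Sum>xs\<in>G_elems m. \<Prod>l<length m. f (Suc l) (xs ! l))"
    by (simp add: sum.cartesian_product[symmetric] sum_product)
  also have "\<dots> = (\<Prod>l<length (a # m). \<Sum>x<(a # m) ! l. f l x)"
    by (simp add: Cons.IH[of "\<lambda>l. f (Suc l)"] prod.lessThan_Suc_shift del: prod.lessThan_Suc)
  finally show ?case .
qed simp

lemma G_elems_eqI:
  assumes "i \<in> G_elems m" "j \<in> G_elems m" "\<And>l. l < length m \<Longrightarrow> i ! l = j ! l"
  shows "i = j"
  using assms by (auto simp: G_elems_def intro: nth_equalityI)

text \<open>Choosing the solution in each component gives the solution in the group. Equations
  between group elements are reduced in this way to congruences modulo a single
  \<open>m ! l\<close>.\<close>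

lemma ex1_G_elems:
  assumes "\<And>l. l < length m \<Longrightarrow> \<exists>!x. x < m ! l \<and> P l x"
  shows "\<exists>!j. j \<in> G_elems m \<and> (\<forall>l<length m. P l (j ! l))"
proof -
  obtain f where f: "\<And>l. l < length m \<Longrightarrow> f l < m ! l \<and> P l (f l)"
    using assms by metis
  show ?thesis
  proof (rule ex1I[of _ "map f [0..<length m]"])
    show "map f [0..<length m] \<in> G_elems m \<and> (\<forall>l<length m. P l (map f [0..<length m] ! l))"
      using f by (auto simp: G_elems_def)
    fix j assume j: "j \<in> G_elems m \<and> (\<forall>l<length m. P l (j ! l))"
    show "j = map f [0..<length m]"
    proof (rule nth_equalityI)
      show "length j = length (map f [0..<length m])" using j by (simp add: G_elems_def)
      fix l assume "l < length j"
      then have l: "l < length m" using j by (simp add: G_elems_def)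
      then have "j ! l < m ! l" "P l (j ! l)" using j by (auto simp: G_elems_def)
      then have "j ! l = f l" using f[OF l] assms[OF l] by blast
      then show "j ! l = map f [0..<length m] ! l" using l by simp
    qed
  qed
qed

section \<open>Translation and the reflection i -> -i - 1\<close>

lemma length_G_add [simp]: "length (G_add m i j) = length m"
  and length_G_reflect [simp]: "length (G_reflect m i) = length m"
  by (simp_all add: G_add_def G_reflect_def)

lemma nth_G_add: "l < length m \<Longrightarrow> G_add m i j ! l = (i ! l + j ! l) mod m ! l"
  and nth_G_reflect: "l < length m \<Longrightarrow> G_reflect m i ! l = m ! l - i ! l - 1"
  by (simp_all add: G_add_def G_reflect_def)

lemma G_add_closed: "\<forall>l<length m. 0 < m ! l \<Longrightarrow> G_add m i j \<in> G_elems m"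
  by (auto simp: G_elems_def G_add_def)

lemma G_add_commute: "G_add m i j = G_add m j i"
  by (simp add: G_add_def add.commute)

lemma G_reflect_closed: "\<forall>l<length m. 0 < m ! l \<Longrightarrow> G_reflect m i \<in> G_elems m"
  by (auto simp: G_elems_def G_reflect_def)

lemma G_reflect_reflect: "i \<in> G_elems m \<Longrightarrow> G_reflect m (G_reflect m i) = i"
  by (auto simp: G_elems_def G_reflect_def intro!: nth_equalityI)

lemma ex1_add_mod_eq:
  fixes a k g :: nat
  assumes "g < a"
  shows "\<exists>!x. x < a \<and> (x + k) mod a = g"
proof (rule ex1I)
  \<comment> \<open>The witness is g - k reduced modulo a; writing -k as \<open>a - k mod a\<close>
    keeps the truncated subtraction of naturals exact.\<close>
  define y where "y = (g + (a - k mod a)) mod a"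
  have "g + (a - k mod a) + k mod a = g + a"
    using mod_less_divisor[of a k] assms by linarith
  moreover have "(y + k) mod a = (g + (a - k mod a) + k mod a) mod a"
    unfolding y_def by (simp only: mod_add_left_eq mod_add_right_eq)
  ultimately have "(y + k) mod a = (g + a) mod a"
    by simp
  then show y: "y < a \<and> (y + k) mod a = g"
    using assms by (simp add: y_def)
  fix x assume x: "x < a \<and> (x + k) mod a = g"
  then have "[x + k = y + k] (mod a)"
    using y by (simp add: cong_def)
  then have "[x = y] (mod a)"
    by (simp only: cong_add_rcancel_nat)
  then show "x = y"
    using x y by (simp add: cong_def)
qed

text \<open>Modulo a the number a - j - 1 is -j - 1, so collecting j on one side leaves a linear
  congruence for 2j. It is stated over the integers because y - x - 1 may be negative.\<close>

lemma add_mod_eq_reflect_iff: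
  fixes a x y j :: nat
  assumes "j < a"
  shows "(j + x) mod a = (a - j - 1 + y) mod a \<longleftrightarrow> [2 * int j = int y - int x - 1] (mod int a)"
proof -
  have "(j + x) mod a = (a - j - 1 + y) mod a \<longleftrightarrow> [int (j + x) = int (a - j - 1 + y)] (mod int a)"
    by (simp only: cong_int_iff) (simp only: cong_def)
  also have "\<dots> \<longleftrightarrow> int a dvd (int j + int x - (int a - int j - 1 + int y))"
    using assms by (simp add: cong_iff_dvd_diff of_nat_diff)
  also have "int j + int x - (int a - int j - 1 + int y) = 2 * int j - (int y - int x - 1) - int a"
    by simp
  also have "int a dvd \<dots> \<longleftrightarrow> int a dvd 2 * int j - (int y - int x - 1)"
    by (metis dvd_diff_left_iff dvd_refl)
  finally show ?thesis by (simp add: cong_iff_dvd_diff)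
qed

text \<open>Oddness makes 2 invertible modulo a, so the linear congruence for 2j has exactly one
  residue as its solution.\<close>

lemma ex1_reflect_mod_eq:
  fixes a x y :: nat
  assumes "odd a"
  shows "\<exists>!j. j < a \<and> (j + x) mod a = (a - j - 1 + y) mod a"
proof -
  define d where "d = int y - int x - 1"
  have a: "coprime 2 (int a)" "0 < a" using assms by (auto simp: odd_pos)
  have "\<exists>!j. j < a \<and> [2 * int j = d] (mod int a)"
  proof (rule ex_ex1I)
    obtain u where u: "[2 * u = 1] (mod int a)" using cong_solve_coprime_int[OF a(1)] by auto
    have "[2 * ((u * d) mod int a) = d] (mod int a)"
      using cong_mult[OF u cong_refl[of d]] by (simp add: cong_def mod_mult_right_eq mult.assoc)
    then show "\<exists>j<a. [2 * int j = d] (mod int a)"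
      using a(2) by (intro exI[of _ "nat ((u * d) mod int a)"]) (simp add: nat_less_iff)
  next
    fix j j' assume *: "j < a \<and> [2 * int j = d] (mod int a)" "j' < a \<and> [2 * int j' = d] (mod int a)"
    then have "[2 * int j = 2 * int j'] (mod int a)" by (meson cong_trans cong_sym)
    then have "[int j = int j'] (mod int a)" using a(1) by (simp add: cong_mult_lcancel)
    then show "j = j'" using * by (simp add: cong_int_iff cong_def)
  qed
  then show ?thesis
    by (simp only: d_def add_mod_eq_reflect_iff cong: conj_cong)
qed

lemma ex1_G_add:
  assumes "g \<in> G_elems m"
  shows "\<exists>!j. j \<in> G_elems m \<and> G_add m j k = g"
proof -
  have "\<exists>!j. j \<in> G_elems m \<and> (\<forall>l<length m. (j ! l + k ! l) mod m ! l = g ! l)"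
    by (rule ex1_G_elems, rule ex1_add_mod_eq) (use assms in \<open>simp add: G_elems_def\<close>)
  moreover have "(\<forall>l<length m. (j ! l + k ! l) mod m ! l = g ! l) \<longleftrightarrow> G_add m j k = g" for j
    unfolding list_eq_iff_nth_eq[of "G_add m j k"]
    using assms by (auto simp: nth_G_add G_elems_def)
  ultimately show ?thesis by (simp only:)
qed

lemma G_add_cancel:
  assumes "i \<in> G_elems m" "j \<in> G_elems m" "\<forall>l<length m. 0 < m ! l"
  shows "G_add m i k = G_add m j k \<longleftrightarrow> i = j" "G_add m k i = G_add m k j \<longleftrightarrow> i = j"
proof -
  show *: "G_add m i k = G_add m j k \<longleftrightarrow> i = j" for k
    using ex1_G_add[OF G_add_closed[OF assms(3), of i k], of k] assms(1,2) by metis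
  show "G_add m k i = G_add m k j \<longleftrightarrow> i = j"
    using *[of k] by (simp only: G_add_commute)
qed

text \<open>The element j locates the coordinate at which the vectors of two distinct points x and y
  are both nonzero: its group label is the common value of j + x and -j - 1 + y.\<close>

lemma ex1_G_reflect:
  assumes "\<forall>l<length m. odd (m ! l)"
  shows "\<exists>!j. j \<in> G_elems m \<and> G_add m j x = G_add m (G_reflect m j) y"
proof -
  have "\<exists>!j. j \<in> G_elems m \<and>
      (\<forall>l<length m. (j ! l + x ! l) mod m ! l = (m ! l - j ! l - 1 + y ! l) mod m ! l)"
    by (rule ex1_G_elems, rule ex1_reflect_mod_eq) (use assms in simp)
  moreover have "(\<forall>l<length m. (j ! l + x ! l) mod m ! l = (m ! l - j ! l - 1 + y ! l) mod m ! l)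
      \<longleftrightarrow> G_add m j x = G_add m (G_reflect m j) y" for j
    unfolding list_eq_iff_nth_eq[of "G_add m j x"] by (auto simp: nth_G_add nth_G_reflect)
  ultimately show ?thesis by (simp only:)
qed

section \<open>The fixed point c of the reflection and the lexicographic order around it\<close>

definition G_mid :: "nat list \<Rightarrow> nat list" where
  "G_mid m = map (\<lambda>n. (n - 1) div 2) m"

lemma G_mid_closed: "\<forall>l<length m. 0 < m ! l \<Longrightarrow> G_mid m \<in> G_elems m"
  by (fastforce simp: G_elems_def G_mid_def)

lemma G_reflect_mid: "\<forall>l<length m. odd (m ! l) \<Longrightarrow> G_reflect m (G_mid m) = G_mid m"
proof -
  assume m: "\<forall>l<length m. odd (m ! l)"
  have "n - (n - 1) div 2 - 1 = (n - 1) div 2" if "odd n" for n :: nat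
    using that by (auto elim: oddE)
  with m show ?thesis
    by (auto simp: G_reflect_def G_mid_def intro!: nth_equalityI)
qed

lemma G_reflect_Cons: "G_reflect (a # m) (x # xs) = (a - x - 1) # G_reflect m xs"
  by (simp add: G_reflect_def upt_conv_Cons map_Suc_upt[symmetric] del: upt_Suc)

text \<open>In one component the reflection reverses the order around the midpoint and maps only the
  midpoint to itself. The first component that differs from the midpoint therefore decides both
  lexicographic comparisons, in opposite directions.\<close>

lemma G_reflect_less_mid_iff:
  assumes "i \<in> G_elems m" "\<forall>l<length m. odd (m ! l)"
  shows "G_reflect m i < G_mid m \<longleftrightarrow> G_mid m < i"
  using assms
proof (induction m arbitrary: i)
  case (Cons a m)
  obtain x xs where i: "i = x # xs" "x < a" "xs \<in> G_elems m"
    using Cons.prems(1) by (auto simp: G_elems_Cons)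
  have a: "odd a" and m: "\<forall>l<length m. odd (m ! l)"
    using Cons.prems(2) by (auto simp: All_less_Suc2)
  have "a - x - 1 < (a - 1) div 2 \<longleftrightarrow> (a - 1) div 2 < x"
    "a - x - 1 = (a - 1) div 2 \<longleftrightarrow> (a - 1) div 2 = x"
    using a i(2) by (auto elim!: oddE)
  then show ?case
    using Cons.IH[OF i(3) m] by (simp add: i(1) G_reflect_Cons G_mid_def)
qed (simp add: G_reflect_def G_mid_def)

lemma I_elems_iff: "i \<in> I_elems m \<longleftrightarrow> i \<in> G_elems m \<and> i < G_mid m"
  by (simp add: I_elems_def G_mid_def)

section \<open>The lexicographic enumeration of the group\<close>

lemma set_G_list [simp]: "set (G_list m) = G_elems m"
  and distinct_G_list [simp]: "distinct (G_list m)"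
  and length_G_list [simp]: "length (G_list m) = prod_list m"
  by (simp_all add: G_list_def card_G_elems)

lemma bij_betw_G_list: "bij_betw ((!) (G_list m)) {..<prod_list m} (G_elems m)"
  by (rule bij_betw_nth) simp_all

section \<open>Orthogonality of characters\<close>

lemma primitive_root_cmod:
  assumes "primitive_root_of_unity n z" "0 < n"
  shows "cmod z = 1"
proof -
  have "cmod z ^ n = 1"
    using assms(1) by (simp add: primitive_root_of_unity_def norm_power[symmetric])
  then show ?thesis using assms(2) using power_eq_imp_eq_base[of "cmod z" n 1] by simp
qed

lemma primitive_root_power_eq:
  assumes z: "primitive_root_of_unity n z" and "x < n" "y < n" "z ^ x = z ^ y"
  shows "x = y"
  using assms(2-)
proof (induction x y rule: linorder_wlog)
  case (le x y)
  have "cmod z = 1" using primitive_root_cmod[OF z] le by simp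
  then have "z \<noteq> 0" by auto
  have "z ^ x * z ^ (y - x) = z ^ y"
    using le(1) by (simp add: power_add[symmetric])
  also have "z ^ y = z ^ x * 1"
    using le(4) by simp
  finally have "z ^ (y - x) = 1"
    using \<open>z \<noteq> 0\<close> by (simp only: mult_cancel_left) simp
  then have "\<not> (0 < y - x \<and> y - x < n)"
    using z by (auto simp: primitive_root_of_unity_def)
  then show ?case using le(1,3) by linarith
next
  case (sym x y)
  show ?case using sym(1)[OF sym(3,2) sym(4)[symmetric]] by simp
qed

text \<open>The sum is geometric with ratio w = \<open>z ^ x * cnj (z ^ y)\<close>. Since w ^ n = 1,
  it vanishes unless w = 1, which happens only for x = y.\<close>

lemma primitive_root_orthogonality:
  assumes z: "primitive_root_of_unity n z" and xy: "x < n" "y < n"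
  shows "(\<Sum>k<n. z ^ (k * x) * cnj (z ^ (k * y))) = (if x = y then of_nat n else 0)"
proof -
  have z1: "cmod z = 1" using primitive_root_cmod[OF z] xy by simp
  then have zz: "z * cnj z = 1" by (simp add: complex_norm_square[symmetric])
  define w where "w = z ^ x * cnj (z ^ y)"
  have "(\<Sum>k<n. z ^ (k * x) * cnj (z ^ (k * y))) = (\<Sum>k<n. w ^ k)"
    by (simp add: w_def power_mult_distrib power_mult[symmetric] mult.commute)
  also have "\<dots> = (if x = y then of_nat n else 0)"
  proof (cases "x = y")
    case True
    then have "w = 1" by (simp add: w_def zz flip: power_mult_distrib)
    then show ?thesis using True by simp
  next
    case False
    \<comment> \<open>As z is unimodular, the right-hand side is \<open>z ^ x\<close>; thus w = 1
      would make two powers of z with exponents below n equal.\<close>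
    have "w * z ^ y = z ^ x * (z * cnj z) ^ y"
      by (simp add: w_def power_mult_distrib)
    then have "w \<noteq> 1"
      using False primitive_root_power_eq[OF z xy] by (auto simp: zz)
    moreover have "w ^ n = (z ^ n) ^ x * cnj ((z ^ n) ^ y)"
      by (simp add: w_def power_mult_distrib power_mult[symmetric] mult.commute)
    moreover have "z ^ n = 1"
      using z by (simp add: primitive_root_of_unity_def)
    ultimately show ?thesis using False by (simp add: geometric_sum)
  qed
  finally show ?thesis .
qed

lemma G_char_commute: "G_char m \<zeta> i j = G_char m \<zeta> j i"
  by (simp add: G_char_def mult.commute)

lemma cmod_G_char:
  assumes "\<forall>l<length m. 0 < m ! l" "\<forall>l<length m. primitive_root_of_unity (m ! l) (\<zeta> l)"
  shows "cmod (G_char m \<zeta> i j) = 1"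
  unfolding G_char_def prod_norm[symmetric]
  by (rule prod.neutral) (use assms primitive_root_cmod in \<open>auto simp: norm_power\<close>)

text \<open>The sum factors over the components, and a component in which g and h differ contributes
  a factor 0.\<close>

lemma G_char_orthogonality:
  assumes "\<forall>l<length m. primitive_root_of_unity (m ! l) (\<zeta> l)" "g \<in> G_elems m" "h \<in> G_elems m"
  shows "(\<Sum>\<kappa>\<in>G_elems m. G_char m \<zeta> \<kappa> g * cnj (G_char m \<zeta> \<kappa> h)) =
    (if g = h then of_nat (prod_list m) else 0)"
proof -
  have "(\<Sum>\<kappa>\<in>G_elems m. G_char m \<zeta> \<kappa> g * cnj (G_char m \<zeta> \<kappa> h)) =
      (\<Sum>\<kappa>\<in>G_elems m. \<Prod>l<length m. \<zeta> l ^ (\<kappa> ! l * g ! l) * cnj (\<zeta> l ^ (\<kappa> ! l * h ! l)))"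
    by (simp only: G_char_def cnj_prod prod.distrib)
  also have "\<dots> = (\<Prod>l<length m. \<Sum>x<m ! l. \<zeta> l ^ (x * g ! l) * cnj (\<zeta> l ^ (x * h ! l)))"
    by (rule sum_prod_G_elems)
  also have "\<dots> = (\<Prod>l<length m. if g ! l = h ! l then of_nat (m ! l) else 0)"
    by (rule prod.cong[OF refl], rule primitive_root_orthogonality)
      (use assms in \<open>auto simp: G_elems_def\<close>)
  also have "\<dots> = (if g = h then of_nat (prod_list m) else 0)"
  proof (cases "g = h")
    case True
    have "(\<Prod>l<length m. of_nat (m ! l)) = (of_nat (prod_list m) :: complex)"
      by (simp add: prod.list_conv_set_nth atLeast0LessThan)
    then show ?thesis using True by simp
  next
    case False
    then obtain l where "l < length m" "g ! l \<noteq> h ! l"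
      using G_elems_eqI assms(2,3) by blast
    then show ?thesis using False by auto
  qed
  finally show ?thesis .
qed

section \<open>Frames and simplices from Gram matrices\<close>

text \<open>Exchanging two sums displays the frame operator as analysis (the coefficients
  \<open>w \<bullet>c \<phi> j\<close>) followed by synthesis. In this form its values visibly lie
  in the span of the family.\<close>

lemma frame_operator_mult_vec:
  assumes "\<phi> ` J \<subseteq> carrier_vec N" "w \<in> carrier_vec N"
  shows "frame_operator N J \<phi> *\<^sub>v w = vec N (\<lambda>a. \<Sum>j\<in>J. (w \<bullet>c \<phi> j) * \<phi> j $ a)"
proof (rule eq_vecI)
  fix a assume "a < dim_vec (vec N (\<lambda>a. \<Sum>j\<in>J. (w \<bullet>c \<phi> j) * \<phi> j $ a))"
  then have a: "a < N" by simp
  have d: "dim_vec (\<phi> j) = N" if "j \<in> J" for j using assms(1) that by auto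
  have "(frame_operator N J \<phi> *\<^sub>v w) $ a =
      (\<Sum>b<N. (\<Sum>j\<in>J. \<phi> j $ a * cnj (\<phi> j $ b)) * w $ b)"
    using a assms(2) by (simp add: frame_operator_def scalar_prod_def atLeast0LessThan)
  also have "\<dots> = (\<Sum>j\<in>J. \<Sum>b<N. \<phi> j $ a * cnj (\<phi> j $ b) * w $ b)"
    unfolding sum_distrib_right by (rule sum.swap)
  also have "\<dots> = (\<Sum>j\<in>J. (w \<bullet>c \<phi> j) * \<phi> j $ a)"
    by (rule sum.cong[OF refl])
      (simp add: scalar_prod_def d atLeast0LessThan sum_distrib_left sum_distrib_right mult_ac)
  finally show "(frame_operator N J \<phi> *\<^sub>v w) $ a = vec N (\<lambda>a. \<Sum>j\<in>J. (w \<bullet>c \<phi> j) * \<phi> j $ a) $ a"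
    using a by simp
qed (simp add: frame_operator_def)

text \<open>Combinations are indexed by J and not by the set of vectors, so that repeated vectors
  need no separate treatment.\<close>

lemma sum_in_cspan:
  assumes "finite J" "\<phi> ` J \<subseteq> S" "S \<subseteq> carrier_vec N"
  shows "vec N (\<lambda>a. \<Sum>j\<in>J. c j * \<phi> j $ a) \<in> cspan N S"
  using assms
proof (induction J rule: finite_induct)
  interpret vec_space "TYPE(complex)" N .
  case empty
  have "vec N (\<lambda>a. 0) = (0\<^sub>v N :: complex vec)" by (rule eq_vecI) auto
  moreover have "lincomb (\<lambda>_. 0) {} \<in> span S"
    unfolding span_def by blast
  ultimately show ?case by (simp add: lincomb_def)
next
  interpret vec_space "TYPE(complex)" N .
  case (insert x J)
  have x: "\<phi> x \<in> S" "\<phi> x \<in> carrier_vec N" using insert.prems by auto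
  have "vec N (\<lambda>a. \<Sum>j\<in>insert x J. c j * \<phi> j $ a) =
      c x \<cdot>\<^sub>v \<phi> x + vec N (\<lambda>a. \<Sum>j\<in>J. c j * \<phi> j $ a)"
    by (rule eq_vecI) (use insert.hyps x in auto)
  moreover have "c x \<cdot>\<^sub>v \<phi> x \<in> span S"
    using smult_in_span[OF insert.prems(2) span_mem[OF insert.prems(2) x(1)]] .
  moreover have "vec N (\<lambda>a. \<Sum>j\<in>J. c j * \<phi> j $ a) \<in> span S"
    using insert.IH insert.prems by auto
  ultimately show ?case
    using span_add1[OF insert.prems(2)] by simp
qed

text \<open>The range of the frame operator lies in the span, and a nonzero multiple of the identity
  reaches every vector.\<close>

lemma cspan_eq_carrierI:
  assumes "finite J" "\<phi> ` J \<subseteq> carrier_vec N" "A \<noteq> 0"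
    and "\<And>w. w \<in> carrier_vec N \<Longrightarrow> frame_operator N J \<phi> *\<^sub>v w = A \<cdot>\<^sub>v w"
  shows "cspan N (\<phi> ` J) = carrier_vec N"
proof
  interpret vec_space "TYPE(complex)" N .
  show "span (\<phi> ` J) \<subseteq> carrier_vec N"
    using span_closed[OF assms(2)] by auto
  show "carrier_vec N \<subseteq> span (\<phi> ` J)"
  proof
    fix w :: "complex vec" assume w: "w \<in> carrier_vec N"
    have "frame_operator N J \<phi> *\<^sub>v w \<in> span (\<phi> ` J)"
      unfolding frame_operator_mult_vec[OF assms(2) w]
      by (rule sum_in_cspan[OF assms(1) _ assms(2)]) simp
    then have "inverse A \<cdot>\<^sub>v (A \<cdot>\<^sub>v w) \<in> span (\<phi> ` J)"
      using smult_in_span[OF assms(2)] assms(4)[OF w] by simp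
    then show "w \<in> span (\<phi> ` J)"
      using assms(3) by (simp add: smult_smult_assoc)
  qed
qed

text \<open>Unimodular rescaling is the case of switching in which the unitary and the permutation
  are identities.\<close>

lemma smult_switching_equivalent:
  assumes "\<phi> ` J \<subseteq> carrier_vec N" "\<forall>j\<in>J. cmod (d j) = 1"
  shows "switching_equivalent N J \<phi> (\<lambda>j. d j \<cdot>\<^sub>v \<phi> j)"
proof -
  have "mat_adjoint (1\<^sub>m N) = (1\<^sub>m N :: complex mat)"
    by (rule eq_matI) (auto simp: mat_adjoint_def mat_of_rows_index)
  then have "unitary_mat N (1\<^sub>m N)" by (simp add: unitary_mat_def)
  moreover have "\<forall>j\<in>J. d j \<cdot>\<^sub>v \<phi> j = d j \<cdot>\<^sub>v (1\<^sub>m N *\<^sub>v \<phi> (id j))"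
    using assms(1) by auto
  ultimately show ?thesis
    unfolding switching_equivalent_def using assms(2) permutes_id by blast
qed

text \<open>This is multiplication by (a + 1) times the identity minus the all-ones matrix, the
  shape of the Gram matrix of a simplex for a = n - 1.\<close>

lemma sum_if_eq_delta:
  fixes c :: "'j \<Rightarrow> complex"
  assumes "finite J" "l \<in> J"
  shows "(\<Sum>j\<in>J. c j * (if j = l then a else - 1)) = (a + 1) * c l - (\<Sum>j\<in>J. c j)"
proof -
  have "(\<Sum>j\<in>J. c j * (if j = l then a else - 1)) = (\<Sum>j\<in>J. (if j = l then (a + 1) * c j else 0) - c j)"
    by (rule sum.cong) (auto simp: algebra_simps)
  then show ?thesis using assms by (simp add: sum_subtractf)
qed

text \<open>The Gram matrix is n times the identity minus the all-ones matrix. This alone determines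
  all that a simplex requires: the family is an ETF for its span, and the span has dimension n -
  1.\<close>

locale simplex_gram =
  fixes N n :: nat and J :: "'j set" and \<psi> :: "'j \<Rightarrow> complex vec"
  assumes J: "finite J" "card J = n" "2 \<le> n"
    and carrier: "\<psi> ` J \<subseteq> carrier_vec N"
    and gram: "\<And>j l. j \<in> J \<Longrightarrow> l \<in> J \<Longrightarrow> \<psi> j \<bullet>c \<psi> l = (if j = l then of_nat n - 1 else - 1)"
begin

sublocale vec_space "TYPE(complex)" N .

lemma dim_psi [simp]: "j \<in> J \<Longrightarrow> dim_vec (\<psi> j) = N"
  using carrier by auto

lemma inj: "inj_on \<psi> J"
proof (rule inj_onI)
  fix j l assume jl: "j \<in> J" "l \<in> J" "\<psi> j = \<psi> l"
  show "j = l"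
  proof (rule ccontr)
    assume "j \<noteq> l"
    then have "of_nat n - 1 = (- 1 :: complex)"
      using gram[of j j] gram[of j l] jl by simp
    then show False using J(3) by simp
  qed
qed

lemma sum_gram:
  assumes "J' \<subseteq> J" "l \<in> J'"
  shows "(\<Sum>j\<in>J'. c j * (\<psi> j \<bullet>c \<psi> l)) = of_nat n * c l - (\<Sum>j\<in>J'. c j)"
proof -
  have "(\<Sum>j\<in>J'. c j * (\<psi> j \<bullet>c \<psi> l)) = (\<Sum>j\<in>J'. c j * (if j = l then of_nat n - 1 else - 1))"
    using assms by (intro sum.cong) (auto simp: gram subset_iff)
  then show ?thesis
    using sum_if_eq_delta[OF finite_subset[OF assms(1) J(1)] assms(2)] by simp
qed

text \<open>The squared norm of the sum of the family is the sum of all Gram entries, and each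
  column of the Gram matrix sums to n - n = 0.\<close>

lemma sum_psi: "a < N \<Longrightarrow> (\<Sum>j\<in>J. \<psi> j $ a) = 0"
proof -
  assume a: "a < N"
  define s where "s = vec N (\<lambda>a. \<Sum>j\<in>J. \<psi> j $ a)"
  have "s \<bullet>c s = (\<Sum>b<N. (\<Sum>j\<in>J. \<psi> j $ b) * cnj (\<Sum>l\<in>J. \<psi> l $ b))"
    by (simp add: s_def scalar_prod_def atLeast0LessThan)
  also have "\<dots> = (\<Sum>b<N. \<Sum>j\<in>J. \<Sum>l\<in>J. \<psi> j $ b * cnj (\<psi> l $ b))"
    by (simp only: cnj_sum sum_product)
  also have "\<dots> = (\<Sum>j\<in>J. \<Sum>l\<in>J. \<Sum>b<N. \<psi> j $ b * cnj (\<psi> l $ b))"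
    by (subst sum.swap) (intro sum.cong refl sum.swap)
  also have "\<dots> = (\<Sum>j\<in>J. \<Sum>l\<in>J. 1 * (\<psi> j \<bullet>c \<psi> l))"
    by (intro sum.cong refl) (simp add: scalar_prod_def atLeast0LessThan)
  also have "\<dots> = (\<Sum>l\<in>J. \<Sum>j\<in>J. 1 * (\<psi> j \<bullet>c \<psi> l))"
    by (rule sum.swap)
  also have "\<dots> = (\<Sum>l\<in>J. of_nat n * 1 - (\<Sum>j\<in>J. 1))"
    by (rule sum.cong[OF refl], rule sum_gram[of J _ "\<lambda>_. 1"]) simp_all
  also have "\<dots> = 0" by (simp add: J)
  finally have "s = 0\<^sub>v N"
    using conjugate_square_eq_0_vec[of s N] by (simp add: s_def)
  then have "s $ a = 0" using a by simp
  then show ?thesis using a by (simp add: s_def)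
qed

text \<open>If w has coefficients c_j, then its inner product with the vector of index l is n c_l
  minus the sum of all c_j. The subtracted constant disappears in the synthesis because the vectors
  sum to 0.\<close>

lemma frame_operator_psi:
  assumes "w \<in> span (\<psi> ` J)"
  shows "frame_operator N J \<psi> *\<^sub>v w = of_nat n \<cdot>\<^sub>v w"
proof -
  obtain c where c: "w = lincomb c (\<psi> ` J)"
    using assms finite_in_span[of "\<psi> ` J" w] J(1) carrier by auto
  have w: "w $ a = (\<Sum>j\<in>J. c (\<psi> j) * \<psi> j $ a)" if "a < N" for a
    unfolding c lincomb_index[OF that carrier] by (simp add: sum.reindex[OF inj])
  have wc: "w \<in> carrier_vec N" using assms carrier span_closed by simp
  have wl: "w \<bullet>c \<psi> l = of_nat n * c (\<psi> l) - (\<Sum>j\<in>J. c (\<psi> j))" if l: "l \<in> J" for l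
  proof -
    have "w \<bullet>c \<psi> l = (\<Sum>a<N. \<Sum>j\<in>J. c (\<psi> j) * (\<psi> j $ a * cnj (\<psi> l $ a)))"
      using l wc by (simp add: scalar_prod_def w atLeast0LessThan sum_distrib_right mult.assoc)
    also have "\<dots> = (\<Sum>j\<in>J. c (\<psi> j) * (\<psi> j \<bullet>c \<psi> l))"
      by (subst sum.swap) (use l in \<open>simp add: scalar_prod_def atLeast0LessThan sum_distrib_left\<close>)
    finally show ?thesis using sum_gram[OF order_refl l] by simp
  qed
  show ?thesis
  proof (rule eq_vecI)
    fix a assume "a < dim_vec (of_nat n \<cdot>\<^sub>v w)"
    then have a: "a < N" using wc by simp
    have "(frame_operator N J \<psi> *\<^sub>v w) $ a =
        (\<Sum>l\<in>J. (of_nat n * c (\<psi> l) - (\<Sum>j\<in>J. c (\<psi> j))) * \<psi> l $ a)"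
      using a by (simp add: frame_operator_mult_vec[OF carrier wc] wl)
    also have "\<dots> = of_nat n * (\<Sum>l\<in>J. c (\<psi> l) * \<psi> l $ a) - (\<Sum>j\<in>J. c (\<psi> j)) * (\<Sum>l\<in>J. \<psi> l $ a)"
      by (simp add: left_diff_distrib sum_subtractf sum_distrib_left mult.assoc)
    finally show "(frame_operator N J \<psi> *\<^sub>v w) $ a = (of_nat n \<cdot>\<^sub>v w) $ a"
      using a wc by (simp add: w sum_psi)
  qed (use wc in \<open>simp add: frame_operator_def\<close>)
qed

lemma etf_for_span: "etf_for N (span (\<psi> ` J)) J \<psi>"
proof -
  have "\<exists>\<alpha>. \<forall>j\<in>J. \<forall>l\<in>J. j \<noteq> l \<longrightarrow> cmod (\<psi> j \<bullet>c \<psi> l) = \<alpha>"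
    by (rule exI[of _ 1]) (simp add: gram)
  moreover have "\<exists>r. \<forall>j\<in>J. \<psi> j \<bullet>c \<psi> j = r"
    by (simp add: gram)
  ultimately show ?thesis
    unfolding etf_for_def using J(1) carrier frame_operator_psi by blast
qed

text \<open>The n vectors are dependent, since they sum to 0, and any n - 1 of them are independent.
  So a maximal independent subset has n - 1 elements.\<close>

lemma dim_span_psi: "cdim N (span (\<psi> ` J)) + 1 = n"
proof -
  obtain j0 where j0: "j0 \<in> J" using J by fastforce
  define J' where "J' = J - {j0}"
  have J': "J' \<subseteq> J" "finite J'" "card J' = n - 1" using J j0 by (auto simp: J'_def)
  have fin: "finite (\<psi> ` J')" and car: "\<psi> ` J' \<subseteq> carrier_vec N"
    using J' carrier by auto
  have indep: "lin_indpt (\<psi> ` J')"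
  proof (rule finite_lin_indpt2[OF fin car])
    fix c :: "complex vec \<Rightarrow> complex"
    assume "lincomb c (\<psi> ` J') = 0\<^sub>v N"
    then have z: "(\<Sum>j\<in>J'. c (\<psi> j) * \<psi> j $ a) = 0" if "a < N" for a
      using lincomb_index[OF that car, of c] that
      by (simp add: sum.reindex[OF inj_on_subset[OF inj J'(1)]])
    \<comment> \<open>Pairing the relation with one of its vectors gives n c_l = s, where s is the
      sum of the coefficients.\<close>
    have e: "of_nat n * c (\<psi> l) = (\<Sum>j\<in>J'. c (\<psi> j))" if l: "l \<in> J'" for l
    proof -
      have "(\<Sum>j\<in>J'. c (\<psi> j) * (\<psi> j \<bullet>c \<psi> l)) = (\<Sum>j\<in>J'. \<Sum>a<N. c (\<psi> j) * \<psi> j $ a * cnj (\<psi> l $ a))"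
        using l J'(1) by (simp add: scalar_prod_def atLeast0LessThan sum_distrib_left mult.assoc subset_iff)
      also have "\<dots> = (\<Sum>a<N. (\<Sum>j\<in>J'. c (\<psi> j) * \<psi> j $ a) * cnj (\<psi> l $ a))"
        by (subst sum.swap) (simp add: sum_distrib_right)
      also have "\<dots> = 0" by (simp add: z)
      finally show ?thesis using sum_gram[OF J'(1) l] by simp
    qed
    \<comment> \<open>Summing n c_l = s over the n - 1 indices gives n s = (n - 1) s. Hence s = 0,
      and then every c_l is 0.\<close>
    have "of_nat n * (\<Sum>j\<in>J'. c (\<psi> j)) = (\<Sum>l\<in>J'. \<Sum>j\<in>J'. c (\<psi> j))"
      unfolding sum_distrib_left by (rule sum.cong) (simp_all add: e)
    also have "\<dots> = (of_nat n - 1) * (\<Sum>j\<in>J'. c (\<psi> j))"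
      using J J'(3) by (simp add: of_nat_diff)
    finally have "(\<Sum>j\<in>J'. c (\<psi> j)) = 0" by (simp add: left_diff_distrib)
    then show "\<forall>v\<in>\<psi> ` J'. c v = 0" using e J(3) by auto
  qed
  have dep: "lin_dep (\<psi> ` J)"
  proof (rule lin_dep_crit[where A = "\<psi> ` J" and a = "\<lambda>_. 1" and v = "\<psi> j0"])
    show "lincomb (\<lambda>_. 1) (\<psi> ` J) = 0\<^sub>v N"
    proof (rule eq_vecI)
      fix a assume "a < dim_vec (0\<^sub>v N :: complex vec)"
      then show "lincomb (\<lambda>_. 1) (\<psi> ` J) $ a = 0\<^sub>v N $ a"
        by (simp add: lincomb_index[OF _ carrier] sum.reindex[OF inj] sum_psi)
    qed (use lincomb_dim[OF _ carrier] J(1) in simp)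
  qed (use J(1) j0 in auto)
  have "maximal (\<psi> ` J') (\<lambda>T. T \<subseteq> \<psi> ` J \<and> lin_indpt T)"
    unfolding maximal_def
  proof (intro conjI allI impI indep)
    show "\<psi> ` J' \<subseteq> \<psi> ` J" using J'(1) by auto
    fix B assume B: "\<psi> ` J' \<subseteq> B \<and> B \<subseteq> \<psi> ` J \<and> lin_indpt B"
    have "\<psi> ` J = insert (\<psi> j0) (\<psi> ` J')" using j0 by (auto simp: J'_def)
    then have "B = \<psi> ` J' \<or> B = \<psi> ` J" using B by auto
    then show "B = \<psi> ` J'" using B dep by auto
  qed
  from dim_span[OF _ _ this] have "cdim N (span (\<psi> ` J)) = card (\<psi> ` J')"
    using carrier J(1) by simp
  also have "\<dots> = n - 1" using J'(3) inj_on_subset[OF inj J'(1)] by (simp add: card_image)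
  finally show ?thesis using J(3) by simp
qed

end

section \<open>Blocks and signs\<close>

lemma nth_concat_equal_length:
  assumes "\<forall>x\<in>set xs. length x = n" "p < length xs" "q < n"
  shows "concat xs ! (p * n + q) = xs ! p ! q"
  using assms
proof (induction xs arbitrary: p)
  case (Cons x xs)
  show ?case
  proof (cases p)
    case 0
    then show ?thesis using Cons.prems by (simp add: nth_append)
  next
    case (Suc p')
    then have "concat xs ! (p' * n + q) = xs ! p' ! q"
      using Cons by simp
    then show ?thesis using Cons.prems Suc by (simp add: nth_append)
  qed
qed simp

section \<open>Odd moduli: the group as midpoint, half \<open>I\<close> and reflected half\<close>

locale odd_moduli =
  fixes m :: "nat list"
  assumes m_Nil: "m \<noteq> []"
    and m_odd: "\<forall>l<length m. odd (m ! l) \<and> 3 \<le> m ! l"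
begin

abbreviation "G \<equiv> G_elems m"
abbreviation "I \<equiv> I_elems m"
abbreviation "n \<equiv> prod_list m"
abbreviation plus :: "nat list \<Rightarrow> nat list \<Rightarrow> nat list" (infixl \<open>\<boxplus>\<close> 65) where
  "i \<boxplus> j \<equiv> G_add m i j"
abbreviation "\<rho> \<equiv> G_reflect m"
abbreviation "mid \<equiv> G_mid m"

lemma odd: "\<forall>l<length m. odd (m ! l)"
  and pos: "\<forall>l<length m. 0 < m ! l"
  using m_odd by (auto intro: odd_pos)

lemmas plus_closed = G_add_closed[OF pos]
lemmas reflect_closed = G_reflect_closed[OF pos]
lemmas mid_closed = G_mid_closed[OF pos]
lemmas reflect_mid = G_reflect_mid[OF odd]
lemmas plus_cancel = G_add_cancel[OF _ _ pos]

lemma mid_notin_I: "mid \<notin> I"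
  by (simp add: I_elems_iff)

lemma I_subset: "I \<subseteq> G"
  by (auto simp: I_elems_iff)

text \<open>An element other than the midpoint lies strictly below or strictly above it, and the
  reflection exchanges the two sides.\<close>

lemma reflect_in_I_iff: "j \<in> G \<Longrightarrow> j \<noteq> mid \<Longrightarrow> \<rho> j \<in> I \<longleftrightarrow> j \<notin> I"
  using G_reflect_less_mid_iff[OF _ odd, of j] reflect_closed[of j]
  by (auto simp: I_elems_iff)

lemma reflect_I:
  assumes "i \<in> I"
  shows "\<rho> i \<in> G" "\<rho> i \<notin> I" "\<rho> i \<noteq> i" "\<rho> i \<noteq> mid" "\<rho> (\<rho> i) = i"
proof -
  have i: "i \<in> G" "i \<noteq> mid" using assms I_subset mid_notin_I by auto
  show "\<rho> i \<in> G" by (rule reflect_closed)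
  show "\<rho> (\<rho> i) = i" using i by (simp add: G_reflect_reflect)
  show "\<rho> i \<notin> I" using reflect_in_I_iff[OF i] assms by simp
  then show "\<rho> i \<noteq> i" using assms by auto
  show "\<rho> i \<noteq> mid" using \<open>\<rho> (\<rho> i) = i\<close> i reflect_mid by auto
qed

lemma finite_I [simp]: "finite I"
  using finite_subset[OF I_subset] by simp

text \<open>The group is the disjoint union of the midpoint, \<open>I\<close> and the reflection of
  \<open>I\<close>.\<close>

lemma card_I: "n = 2 * card I + 1"
proof -
  have "G = insert mid (I \<union> \<rho> ` I)"
  proof
    show "G \<subseteq> insert mid (I \<union> \<rho> ` I)"
    proof
      fix j assume j: "j \<in> G"
      show "j \<in> insert mid (I \<union> \<rho> ` I)"
      proof (cases "j = mid \<or> j \<in> I")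
        case False
        then have "\<rho> j \<in> I" using reflect_in_I_iff[OF j] by simp
        moreover have "j = \<rho> (\<rho> j)" using j by (simp add: G_reflect_reflect)
        ultimately show ?thesis by blast
      qed auto
    qed
    show "insert mid (I \<union> \<rho> ` I) \<subseteq> G"
      using I_subset mid_closed reflect_closed by auto
  qed
  moreover have "mid \<notin> I \<union> \<rho> ` I"
    using mid_notin_I reflect_I(4) by fastforce
  moreover have "I \<inter> \<rho> ` I = {}"
    using reflect_I(2) by auto
  moreover have "card (\<rho> ` I) = card I"
    by (rule card_image) (metis inj_onI reflect_I(5))
  ultimately show ?thesis
    using card_G_elems[of m] by (simp add: card_Un_disjoint)
qed

lemma n_ge: "3 \<le> n"
proof -
  \<comment> \<open>The zero element differs from the midpoint because the first modulus is at least
    3. So it or its reflection lies in \<open>I\<close>, which is therefore nonempty.\<close>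
  define z where "z = map (\<lambda>_. 0 :: nat) m"
  have m0: "0 < length m" "3 \<le> m ! 0" using m_Nil m_odd by simp_all
  have "z \<in> G" using pos by (simp add: z_def G_elems_def)
  moreover have "z ! 0 \<noteq> mid ! 0" using m0 by (simp add: z_def G_mid_def)
  then have "z \<noteq> mid" by auto
  ultimately have "z \<in> I \<or> \<rho> z \<in> I" using reflect_in_I_iff[of z] by simp
  then have "card I \<noteq> 0" using card_eq_0_iff[of I] by auto
  then show ?thesis using card_I by linarith
qed

text \<open>A coordinate carries a label (i, g): i selects the copy of \<open>\<phi>\<^sub>i\<close>
  inside \<psi>, and g the entry in that copy. Its block consists of the translations k for which
  this entry of the translated vector is nonzero.\<close>

definition block :: "nat list \<times> nat list \<Rightarrow> nat list set" where
  "block = (\<lambda>(i, g). {k \<in> G. g = i \<boxplus> k \<or> g = \<rho> i \<boxplus> k})"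

lemma in_block: "k \<in> block (i, g) \<longleftrightarrow> k \<in> G \<and> (g = i \<boxplus> k \<or> g = \<rho> i \<boxplus> k)"
  by (simp add: block_def)

text \<open>Write g = j + k. As j is not the midpoint, exactly one of j and its reflection lies in
  \<open>I\<close>, and this is the required index.\<close>

lemma ex1_block:
  assumes "k \<in> G" "g \<in> G" "g \<noteq> mid \<boxplus> k"
  shows "\<exists>!i. i \<in> I \<and> k \<in> block (i, g)"
proof -
  obtain j where j: "j \<in> G" "g = j \<boxplus> k" using ex1_G_add[OF assms(2), of k] by metis
  then have "j \<noteq> mid" using assms(3) by auto
  have eq: "k \<in> block (i, g) \<longleftrightarrow> j = i \<or> j = \<rho> i" if "i \<in> I" for i
    using that I_subset reflect_closed j assms(1) by (auto simp: in_block plus_cancel)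
  show ?thesis
  proof (cases "j \<in> I")
    case True
    then show ?thesis using eq reflect_I(2) by (intro ex1I[of _ j]) auto
  next
    case False
    then have *: "\<rho> j \<in> I" "\<rho> (\<rho> j) = j"
      using reflect_in_I_iff j \<open>j \<noteq> mid\<close> by (auto simp: G_reflect_reflect)
    then show ?thesis
      using eq False reflect_I(5) by (intro ex1I[of _ "\<rho> j"]) auto
  qed
qed

lemma not_in_block_mid: "i \<in> I \<Longrightarrow> k \<notin> block (i, mid \<boxplus> k)"
  using plus_cancel(1)[OF mid_closed] I_subset mid_notin_I reflect_I(1,4)
  by (metis in_block subsetD)

text \<open>If x and y share a block (i, g), then one of them is reached from i and the other from
  the reflection of i, since cancellation excludes x and y on the same side. This is the equation j
  + x = -j - 1 + y with j equal to i or its reflection. It has one solution j, and \<open>I\<close>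
  contains exactly one of j and its reflection.\<close>

lemma ex1_common_block:
  assumes xy: "x \<in> G" "y \<in> G" "x \<noteq> y"
  shows "\<exists>!p. p \<in> I \<times> G \<and> x \<in> block p \<and> y \<in> block p"
proof -
  obtain j where j: "j \<in> G" "j \<boxplus> x = \<rho> j \<boxplus> y"
    and uniq: "\<And>j'. j' \<in> G \<Longrightarrow> j' \<boxplus> x = \<rho> j' \<boxplus> y \<Longrightarrow> j' = j"
    using ex1_G_reflect[OF odd, of x y] by metis
  \<comment> \<open>For the self-reflected midpoint the equation would read mid + x = mid + y and
    force x = y.\<close>
  have "j \<noteq> mid"
    using j(2) xy plus_cancel(2)[OF xy(1,2)] reflect_mid by auto
  define i where "i = (if j \<in> I then j else \<rho> j)"
  have i: "i \<in> I" using reflect_in_I_iff[OF j(1) \<open>j \<noteq> mid\<close>] by (simp add: i_def)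
  have ij: "j = i \<and> \<rho> j = \<rho> i \<or> j = \<rho> i \<and> \<rho> j = i"
    using j(1) by (auto simp: i_def G_reflect_reflect)
  show ?thesis
  proof (rule ex1I[of _ "(i, j \<boxplus> x)"])
    have "x \<in> block (i, j \<boxplus> x)" "y \<in> block (i, j \<boxplus> x)"
      using ij xy j(2) by (metis in_block)+
    then show "(i, j \<boxplus> x) \<in> I \<times> G \<and> x \<in> block (i, j \<boxplus> x) \<and> y \<in> block (i, j \<boxplus> x)"
      using i plus_closed by auto
  next
    fix p assume p: "p \<in> I \<times> G \<and> x \<in> block p \<and> y \<in> block p"
    obtain i' g' where p': "p = (i', g')" by fastforce
    have i': "i' \<in> I" "i' \<in> G" "\<rho> i' \<in> G" "\<rho> (\<rho> i') = i'"
      using p p' I_subset reflect_I by auto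
    have "g' = i' \<boxplus> x \<or> g' = \<rho> i' \<boxplus> x" "g' = i' \<boxplus> y \<or> g' = \<rho> i' \<boxplus> y"
      using p p' by (auto simp: in_block)
    then have "g' = i' \<boxplus> x \<and> g' = \<rho> i' \<boxplus> y \<or> g' = \<rho> i' \<boxplus> x \<and> g' = i' \<boxplus> y"
      using xy plus_cancel(2)[OF xy(1,2)] by metis
    then have "g' = j \<boxplus> x \<and> (i' = j \<or> \<rho> i' = j)"
      using uniq[of i'] uniq[of "\<rho> i'"] i' by metis
    moreover have "i' = i" if "i' = j \<or> \<rho> i' = j"
      using that i' reflect_I(2)[of i'] by (auto simp: i_def)
    ultimately show "p = (i, j \<boxplus> x)" using p' by blast
  qed
qed

text \<open>Each of the two equations in the definition has one solution, and the solutions differ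
  because i is not its own reflection.\<close>

lemma card_block:
  assumes "i \<in> I" "g \<in> G"
  shows "card (block (i, g)) = 2"
proof -
  have i: "i \<in> G" "\<rho> i \<in> G" "\<rho> i \<noteq> i"
    using I_subset reflect_I(1,3)[OF assms(1)] assms(1) by auto
  have ex: "\<exists>x\<in>G. g = j \<boxplus> x" for j
    using ex1_G_add[OF assms(2), of j] G_add_commute[of m j] by auto
  obtain x where x: "x \<in> G" "g = i \<boxplus> x" using ex by blast
  obtain y where y: "y \<in> G" "g = \<rho> i \<boxplus> y" using ex by blast
  have "x \<noteq> y" using x y i plus_cancel(1)[OF i(1,2), of x] by auto
  moreover have "block (i, g) = {x, y}"
  proof (rule Set.set_eqI)
    fix k
    have "g = i \<boxplus> k \<longleftrightarrow> x = k" if "k \<in> G"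
      unfolding x(2) by (rule plus_cancel(2)[OF x(1) that])
    moreover have "g = \<rho> i \<boxplus> k \<longleftrightarrow> y = k" if "k \<in> G"
      unfolding y(2) by (rule plus_cancel(2)[OF y(1) that])
    ultimately show "k \<in> block (i, g) \<longleftrightarrow> k \<in> {x, y}"
      using x(1) y(1) unfolding in_block by blast
  qed
  ultimately show ?thesis by simp
qed

lemma block_subset: "block p \<subseteq> G"
  by (auto simp: block_def)

text \<open>A block has two points, and two points lie in the block of only one label. Hence labels
  and blocks may be identified.\<close>

lemma inj_on_block: "inj_on block (I \<times> G)"
proof (rule inj_onI)
  fix p q assume p: "p \<in> I \<times> G" and q: "q \<in> I \<times> G" and eq: "block p = block q"
  have "card (block p) = 2" using p card_block by auto
  then obtain x y where xy: "x \<noteq> y" "block p = {x, y}"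
    by (auto simp: card_2_iff)
  then have "x \<in> G" "y \<in> G" using block_subset[of p] by auto
  then show "p = q" using ex1_common_block[of x y] p q eq xy by blast
qed

lemma is_bibd_blocks: "is_bibd G (block ` (I \<times> G)) n 2 1"
  unfolding is_bibd_def
proof (intro conjI ballI impI)
  show "card G = n" by (rule card_G_elems)
  fix B assume "B \<in> block ` (I \<times> G)"
  then show "B \<subseteq> G" "card B = 2" using block_subset card_block by auto
next
  fix x y assume "x \<in> G" "y \<in> G" "x \<noteq> y"
  then obtain p where "p \<in> I \<times> G" "x \<in> block p" "y \<in> block p"
    and "\<And>q. q \<in> I \<times> G \<Longrightarrow> x \<in> block q \<Longrightarrow> y \<in> block q \<Longrightarrow> q = p"
    using ex1_common_block[of x y] by metis
  then have "{B \<in> block ` (I \<times> G). x \<in> B \<and> y \<in> B} = {block p}" by blast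
  then show "card {B \<in> block ` (I \<times> G). x \<in> B \<and> y \<in> B} = 1" by simp
qed simp

text \<open>The entry with label (i, g) of \<psi> translated by k, before modulation.\<close>

definition sign :: "nat list \<Rightarrow> nat list \<times> nat list \<Rightarrow> complex" where
  "sign k = (\<lambda>(i, g). (if g = i \<boxplus> k then 1 else 0) - (if g = \<rho> i \<boxplus> k then 1 else 0))"

lemma sign_cases:
  assumes "p \<in> I \<times> G" "k \<in> G"
  shows "sign k p = (if k \<in> block p then if snd p = fst p \<boxplus> k then 1 else - 1 else 0)"
proof -
  obtain i g where p: "p = (i, g)" "i \<in> I" using assms by auto
  then have "i \<boxplus> k \<noteq> \<rho> i \<boxplus> k"
    using plus_cancel(1)[of i "\<rho> i" k] I_subset reflect_I[of i] by auto
  then show ?thesis using assms by (auto simp: p sign_def in_block)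
qed

lemma sign_mult_sign:
  "p \<in> I \<times> G \<Longrightarrow> k \<in> G \<Longrightarrow> sign k p * sign k p = (if k \<in> block p then 1 else 0)"
  by (simp add: sign_cases)

lemma cnj_sign [simp]: "cnj (sign k p) = sign k p"
  by (cases p) (simp add: sign_def)

text \<open>For fixed k every group label except mid + k is used by exactly one i. This is why the
  vectors of a point form a Fourier matrix with one row deleted.\<close>

lemma sum_I_block:
  assumes "k \<in> G" "g \<in> G"
  shows "(\<Sum>i\<in>I. if k \<in> block (i, g) then 1 else 0 :: complex) = (if g = mid \<boxplus> k then 0 else 1)"
proof (cases "g = mid \<boxplus> k")
  case True
  then show ?thesis using not_in_block_mid by (simp add: sum.neutral)
next
  case False
  then obtain i where i: "i \<in> I" "\<And>i'. i' \<in> I \<Longrightarrow> k \<in> block (i', g) \<longleftrightarrow> i' = i"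
    using ex1_block[OF assms] by metis
  have "(\<Sum>i\<in>I. if k \<in> block (i, g) then 1 else 0 :: complex) = (\<Sum>i'\<in>I. if i' = i then 1 else 0)"
    by (rule sum.cong) (simp_all add: i)
  then show ?thesis using i False by simp
qed

text \<open>For equal labels each of the two points of the block contributes 1. For different i and
  the same g the blocks are disjoint, so every term vanishes.\<close>

lemma sum_sign_sign:
  assumes "(i, g) \<in> I \<times> G" "(i', g) \<in> I \<times> G"
  shows "(\<Sum>k\<in>G. sign k (i, g) * sign k (i', g)) = (if i = i' then 2 else 0)"
proof (cases "i = i'")
  case True
  have "(\<Sum>k\<in>G. sign k (i, g) * sign k (i, g)) = (\<Sum>k\<in>G. if k \<in> block (i, g) then 1 else 0)"
    using assms by (intro sum.cong) (simp_all add: sign_mult_sign)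
  also have "\<dots> = of_nat (card (block (i, g)))"
    using block_subset by (simp add: sum.If_cases Int_absorb1)
  also have "\<dots> = 2" using card_block assms by simp
  finally show ?thesis using True by simp
next
  case False
  have "sign k (i, g) * sign k (i', g) = 0" if k: "k \<in> G" for k
  proof (rule ccontr)
    assume "sign k (i, g) * sign k (i', g) \<noteq> 0"
    then have *: "k \<in> block (i, g)" "k \<in> block (i', g)"
      using sign_cases[OF assms(1) k] sign_cases[OF assms(2) k] by (auto split: if_splits)
    moreover have "g \<noteq> mid \<boxplus> k" using * not_in_block_mid assms by auto
    ultimately show False using ex1_block[OF k, of g] assms False by auto
  qed
  then show ?thesis using False by (simp add: sum.neutral)
qed

definition N :: nat where "N = card I * n"

lemma N_eq: "N = n * (n - 1) div 2"
proof -
  have "n * (n - 1) = 2 * N" using card_I by (simp add: N_def)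
  then show ?thesis by simp
qed

text \<open>Division with remainder by n matches both the concatenation that defines \<psi> and the
  row and column indices of the Kronecker product.\<close>

definition coord :: "nat \<Rightarrow> nat list \<times> nat list" where
  "coord a = (sorted_list_of_set I ! (a div n), G_list m ! (a mod n))"

lemma div_mod_less: "a < N \<Longrightarrow> a div n < card I \<and> a mod n < n"
  using n_ge by (auto simp: N_def less_mult_imp_div_less)

lemma coord_in: "a < N \<Longrightarrow> coord a \<in> I \<times> G"
  using div_mod_less[of a] nth_mem[of "a div n" "sorted_list_of_set I"] nth_mem[of "a mod n" "G_list m"]
  by (simp add: coord_def)

lemma bij_betw_coord: "bij_betw coord {..<N} (I \<times> G)"
proof -
  have inj: "inj_on coord {..<N}"
  proof (rule inj_onI)
    fix a b assume "a \<in> {..<N}" "b \<in> {..<N}" "coord a = coord b"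
    then have "a div n = b div n" "a mod n = b mod n"
      using div_mod_less[of a] div_mod_less[of b]
      by (auto simp: coord_def nth_eq_iff_index_eq)
    then show "a = b" by (metis div_mult_mod_eq)
  qed
  moreover have "coord ` {..<N} = I \<times> G"
  proof (rule card_subset_eq)
    show "coord ` {..<N} \<subseteq> I \<times> G" using coord_in by blast
    show "card (coord ` {..<N}) = card (I \<times> G)"
      using card_image[OF inj] by (simp add: card_cartesian_product card_G_elems N_def)
  qed simp
  ultimately show ?thesis by (simp add: bij_betw_def)
qed

lemma sum_coord: "(\<Sum>a<N. f (coord a)) = (\<Sum>p\<in>I \<times> G. f p)"
  by (rule sum.reindex_bij_betw[OF bij_betw_coord])

end

section \<open>The Gabor--Steiner frame\<close>

locale gabor_steiner_system = odd_moduli m for m :: "nat list" +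
  fixes \<zeta> :: "nat \<Rightarrow> complex"
  assumes roots: "\<forall>l<length m. primitive_root_of_unity (m ! l) (\<zeta> l)"
begin

abbreviation "\<chi> \<equiv> G_char m \<zeta>"
abbreviation "\<Psi> \<equiv> gabor_steiner m \<zeta>"

lemmas cmod_char [simp] = cmod_G_char[OF pos roots]

text \<open>The pairing is symmetric in its two arguments, so the summation may also run over the
  second one.\<close>

lemma orthogonality:
  "\<kappa> \<in> G \<Longrightarrow> \<mu> \<in> G \<Longrightarrow> (\<Sum>g\<in>G. \<chi> \<kappa> g * cnj (\<chi> \<mu> g)) = (if \<kappa> = \<mu> then of_nat n else 0)"
  using G_char_orthogonality[OF roots, of \<kappa> \<mu>]
  by (simp only: G_char_commute[of m \<zeta> _ \<kappa>] G_char_commute[of m \<zeta> _ \<mu>])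

lemma char_mult_cnj [simp]: "\<chi> \<kappa> g * cnj (\<chi> \<kappa> g) = 1"
  by (simp add: complex_norm_square[symmetric])

section \<open>The coordinates of the frame vectors\<close>

lemma basis_vec_index: "q < n \<Longrightarrow> basis_vec m j $ q = (if G_list m ! q = j then 1 else 0)"
  and dim_basis_vec [simp]: "dim_vec (basis_vec m j) = n"
  by (simp_all add: basis_vec_def)

lemma nth_G_list: "q < n \<Longrightarrow> G_list m ! q \<in> G"
  using nth_mem[of q "G_list m"] by simp

lemma modulation_translation_index:
  assumes "q < n" "r < n"
  shows "(modulation_mat m \<zeta> \<kappa> * translation_mat m k) $$ (q, r) =
    (if G_list m ! q = G_list m ! r \<boxplus> k then \<chi> \<kappa> (G_list m ! q) else 0)"
proof -
  have "(modulation_mat m \<zeta> \<kappa> * translation_mat m k) $$ (q, r) =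
      (\<Sum>s<n. modulation_mat m \<zeta> \<kappa> $$ (q, s) * translation_mat m k $$ (s, r))"
    using assms by (simp add: modulation_mat_def translation_mat_def scalar_prod_def atLeast0LessThan)
  \<comment> \<open>The modulation matrix is diagonal, so only s = q survives.\<close>
  also have "\<dots> = (\<Sum>s<n. if s = q then \<chi> \<kappa> (G_list m ! q) * translation_mat m k $$ (q, r) else 0)"
    using assms
    by (intro sum.cong refl)
      (auto simp: modulation_mat_def mat_of_cols_index basis_vec_index nth_eq_iff_index_eq)
  also have "\<dots> = \<chi> \<kappa> (G_list m ! q) * translation_mat m k $$ (q, r)"
    using assms by simp
  finally show ?thesis
    using assms by (simp add: translation_mat_def mat_of_cols_index basis_vec_index)
qed

lemma dim_phi_vec [simp]: "dim_vec (phi_vec m i) = n"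
  by (simp add: phi_vec_def)

lemma dim_psi_vec [simp]: "dim_vec (psi_vec m) = N"
  by (simp add: psi_vec_def length_concat o_def sum_list_triv N_def)

lemma psi_vec_index:
  assumes "a < N"
  shows "psi_vec m $ a = (\<lambda>(i, j). (if j = i then 1 else 0) - (if j = \<rho> i then 1 else 0)) (coord a)"
proof -
  let ?is = "sorted_list_of_set I"
  have a: "a div n < length ?is" "a mod n < n" using div_mod_less[OF assms] by simp_all
  have "psi_vec m $ a = concat (map (\<lambda>i. list_of_vec (phi_vec m i)) ?is) ! (a div n * n + a mod n)"
    by (simp add: psi_vec_def vec_of_list_index)
  also have "\<dots> = phi_vec m (?is ! (a div n)) $ (a mod n)"
    using a by (subst nth_concat_equal_length) auto
  finally show ?thesis
    using a by (simp add: phi_vec_def coord_def basis_vec_index)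
qed

lemma pi_mat_carrier: "pi_mat m \<zeta> (k, \<kappa>) \<in> carrier_mat N N"
  using card_I
  by (simp add: pi_mat_def kronecker_def modulation_mat_def translation_mat_def N_def)

lemma dim_gabor_steiner [simp]: "dim_vec (\<Psi> p) = N"
  using carrier_matD(1)[OF pi_mat_carrier] by (cases p) (simp add: gabor_steiner_def)

text \<open>The identity factor of the Kronecker product keeps the copies apart. Within copy i the
  entries 1 and -1 move to i + k and -i - 1 + k, and modulation multiplies them by the character
  value at their new position.\<close>

lemma gabor_steiner_index:
  assumes a: "a < N"
  shows "\<Psi> (k, \<kappa>) $ a = \<chi> \<kappa> (snd (coord a)) * sign k (coord a)"
proof -
  let ?A = "modulation_mat m \<zeta> \<kappa> * translation_mat m k"
  obtain i g where ig: "coord a = (i, g)" "i \<in> I" "g \<in> G"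
    using coord_in[OF a] by auto
  \<comment> \<open>The product of the matrix entry in row a and the matching entry of \<psi>, as a
    function of the label (i', j) of the column.\<close>
  define h where "h = (\<lambda>(i', j). (if i = i' then 1 else 0) *
    ((if g = j \<boxplus> k then \<chi> \<kappa> g else 0) * ((if j = i' then 1 else 0) - (if j = \<rho> i' then 1 else 0))) :: complex)"
  have entry: "pi_mat m \<zeta> (k, \<kappa>) $$ (a, b) * psi_vec m $ b = h (coord b)" if b: "b < N" for b
  proof -
    have ab: "a div n < card I" "b div n < card I" "a mod n < n" "b mod n < n"
      using div_mod_less a b by auto
    have dims: "(n - Suc 0) div 2 = card I" "dim_row ?A = n" "dim_col ?A = n"
      using card_I by (simp_all add: modulation_mat_def translation_mat_def)
    have "pi_mat m \<zeta> (k, \<kappa>) $$ (a, b) =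
        (if a div n = b div n then 1 else 0) * ?A $$ (a mod n, b mod n)"
      using a b ab unfolding pi_mat_def kronecker_def N_def by (simp add: dims del: index_mult_mat)
    moreover have "a div n = b div n \<longleftrightarrow> i = fst (coord b)"
      using ig(1) ab by (auto simp: coord_def nth_eq_iff_index_eq)
    moreover have "g = G_list m ! (a mod n)" using ig(1) by (simp add: coord_def)
    ultimately show ?thesis
      using modulation_translation_index[OF ab(3,4)] psi_vec_index[OF b]
      by (simp add: h_def coord_def)
  qed
  have "\<Psi> (k, \<kappa>) $ a = (\<Sum>b<N. pi_mat m \<zeta> (k, \<kappa>) $$ (a, b) * psi_vec m $ b)"
    using a pi_mat_carrier[of k \<kappa>]
    by (simp add: gabor_steiner_def scalar_prod_def atLeast0LessThan)
  also have "\<dots> = (\<Sum>b<N. h (coord b))"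
    by (rule sum.cong) (simp_all add: entry)
  also have "\<dots> = (\<Sum>i'\<in>I. \<Sum>j\<in>G. h (i', j))"
    by (simp add: sum_coord sum.cartesian_product)
  also have "\<dots> = (\<Sum>i'\<in>I. if i' = i then \<Sum>j\<in>G. h (i, j) else 0)"
    by (rule sum.cong) (auto simp: h_def)
  also have "\<dots> = (\<Sum>j\<in>G. h (i, j))"
    using ig by simp
  also have "\<dots> = (\<Sum>j\<in>G. if j = i then if g = i \<boxplus> k then \<chi> \<kappa> g else 0 else 0) -
      (\<Sum>j\<in>G. if j = \<rho> i then if g = \<rho> i \<boxplus> k then \<chi> \<kappa> g else 0 else 0)"
    unfolding sum_subtractf[symmetric] by (rule sum.cong) (auto simp: h_def)
  also have "\<dots> = (if g = i \<boxplus> k then \<chi> \<kappa> g else 0) - (if g = \<rho> i \<boxplus> k then \<chi> \<kappa> g else 0)"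
    using ig I_subset reflect_closed by (simp add: subset_iff)
  finally show ?thesis by (simp add: ig sign_def right_diff_distrib)
qed

section \<open>Inner products of the frame vectors\<close>

lemma inner_gabor_steiner:
  "\<Psi> (k, \<kappa>) \<bullet>c \<Psi> (l, \<mu>) =
    (\<Sum>p\<in>I \<times> G. \<chi> \<kappa> (snd p) * cnj (\<chi> \<mu> (snd p)) * (sign k p * sign l p))"
proof -
  let ?f = "\<lambda>p. \<chi> \<kappa> (snd p) * cnj (\<chi> \<mu> (snd p)) * (sign k p * sign l p)"
  have "\<Psi> (k, \<kappa>) \<bullet>c \<Psi> (l, \<mu>) = (\<Sum>a<N. \<Psi> (k, \<kappa>) $ a * cnj (\<Psi> (l, \<mu>) $ a))"
    by (simp add: scalar_prod_def atLeast0LessThan)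
  also have "\<dots> = (\<Sum>a<N. ?f (coord a))"
    by (rule sum.cong) (simp_all add: gabor_steiner_index mult_ac)
  also have "\<dots> = (\<Sum>p\<in>I \<times> G. ?f p)" by (rule sum_coord)
  finally show ?thesis .
qed

text \<open>The squared sign is the indicator of the block. Summing it over \<open>I\<close> leaves
  the full character sum without its term at mid + k.\<close>

lemma inner_same_translation:
  assumes "k \<in> G" "\<kappa> \<in> G" "\<mu> \<in> G"
  shows "\<Psi> (k, \<kappa>) \<bullet>c \<Psi> (k, \<mu>) =
    (if \<kappa> = \<mu> then of_nat n else 0) - \<chi> \<kappa> (mid \<boxplus> k) * cnj (\<chi> \<mu> (mid \<boxplus> k))"
proof -
  let ?f = "\<lambda>g. \<chi> \<kappa> g * cnj (\<chi> \<mu> g)"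
  have "\<Psi> (k, \<kappa>) \<bullet>c \<Psi> (k, \<mu>) = (\<Sum>p\<in>I \<times> G. ?f (snd p) * (if k \<in> block p then 1 else 0))"
    unfolding inner_gabor_steiner using assms by (intro sum.cong) (simp_all add: sign_mult_sign)
  also have "\<dots> = (\<Sum>i\<in>I. \<Sum>g\<in>G. ?f g * (if k \<in> block (i, g) then 1 else 0))"
    by (simp add: sum.cartesian_product case_prod_unfold)
  also have "\<dots> = (\<Sum>g\<in>G. \<Sum>i\<in>I. ?f g * (if k \<in> block (i, g) then 1 else 0))"
    by (rule sum.swap)
  also have "\<dots> = (\<Sum>g\<in>G. ?f g * (if g = mid \<boxplus> k then 0 else 1))"
    using assms(1) by (intro sum.cong refl) (simp only: sum_distrib_left[symmetric] sum_I_block)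
  also have "\<dots> = (\<Sum>g\<in>G. ?f g - (if g = mid \<boxplus> k then ?f g else 0))"
    by (rule sum.cong) auto
  also have "\<dots> = (if \<kappa> = \<mu> then of_nat n else 0) - ?f (mid \<boxplus> k)"
    using orthogonality[OF assms(2,3)] plus_closed by (simp add: sum_subtractf)
  finally show ?thesis .
qed

text \<open>Only the coordinate of the common block of k and l contributes, and its term is a
  product of unimodular numbers.\<close>

lemma cmod_inner_different_translation:
  assumes "k \<in> G" "l \<in> G" "k \<noteq> l"
  shows "cmod (\<Psi> (k, \<kappa>) \<bullet>c \<Psi> (l, \<mu>)) = 1"
proof -
  obtain p where p: "p \<in> I \<times> G" "k \<in> block p" "l \<in> block p"
    and uniq: "\<And>q. q \<in> I \<times> G \<Longrightarrow> k \<in> block q \<Longrightarrow> l \<in> block q \<Longrightarrow> q = p"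
    using ex1_common_block[OF assms] by metis
  let ?f = "\<lambda>q. \<chi> \<kappa> (snd q) * cnj (\<chi> \<mu> (snd q)) * (sign k q * sign l q)"
  have "?f q = 0" if "q \<in> I \<times> G" "q \<noteq> p" for q
    using uniq[of q] that sign_cases[OF that(1) assms(1)] sign_cases[OF that(1) assms(2)] by auto
  then have "(\<Sum>q\<in>I \<times> G. ?f q) = (\<Sum>q\<in>I \<times> G. if q = p then ?f p else 0)"
    by (intro sum.cong) auto
  also have "\<dots> = ?f p"
    using p(1) by (subst sum.delta) auto
  finally have "\<Psi> (k, \<kappa>) \<bullet>c \<Psi> (l, \<mu>) = ?f p"
    unfolding inner_gabor_steiner .
  moreover have "cmod (?f p) = 1"
    using p assms by (simp add: norm_mult sign_cases)
  ultimately show ?thesis by simp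
qed

text \<open>In the entry for labels (i, g) and (i', g') the sum over \<kappa> forces g = g' and
  gives n. The sum of signs over k then forces i = i' and gives 2, so the frame bound is 2n.\<close>

lemma frame_operator_gabor_steiner:
  "frame_operator N (G \<times> G) \<Psi> = (2 * of_nat n) \<cdot>\<^sub>m 1\<^sub>m N"
proof (rule eq_matI)
  fix a b assume "a < dim_row ((2 * of_nat n) \<cdot>\<^sub>m 1\<^sub>m N :: complex mat)"
    and "b < dim_col ((2 * of_nat n) \<cdot>\<^sub>m 1\<^sub>m N :: complex mat)"
  then have ab: "a < N" "b < N" by simp_all
  obtain i g where p: "coord a = (i, g)" "i \<in> I" "g \<in> G" using coord_in[OF ab(1)] by auto
  obtain i' g' where q: "coord b = (i', g')" "i' \<in> I" "g' \<in> G" using coord_in[OF ab(2)] by auto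
  have "(\<Sum>(k, \<kappa>)\<in>G \<times> G. \<Psi> (k, \<kappa>) $ a * cnj (\<Psi> (k, \<kappa>) $ b)) =
      (\<Sum>k\<in>G. \<Sum>\<kappa>\<in>G. sign k (i, g) * sign k (i', g') * (\<chi> \<kappa> g * cnj (\<chi> \<kappa> g')))"
    unfolding sum.cartesian_product
    by (intro sum.cong refl) (auto simp: gabor_steiner_index ab p q mult_ac)
  also have "\<dots> = (\<Sum>k\<in>G. sign k (i, g) * sign k (i', g')) * (if g = g' then of_nat n else 0)"
    by (simp only: sum_distrib_left[symmetric] G_char_orthogonality[OF roots p(3) q(3)]
        sum_distrib_right[symmetric])
  also have "\<dots> = (if (i, g) = (i', g') then 2 * of_nat n else 0)"
    using sum_sign_sign[of i g i'] p q by auto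
  also have "(i, g) = (i', g') \<longleftrightarrow> a = b"
    using bij_betw_coord ab p(1) q(1) by (auto simp: bij_betw_def inj_on_def)
  finally show "frame_operator N (G \<times> G) \<Psi> $$ (a, b) = ((2 * of_nat n) \<cdot>\<^sub>m 1\<^sub>m N) $$ (a, b)"
    using ab by (simp add: frame_operator_def case_prod_unfold)
qed (simp_all add: frame_operator_def)

section \<open>Tightness, equiangularity and the simplices\<close>

lemma gabor_steiner_carrier: "\<Psi> ` J \<subseteq> carrier_vec N"
  by (auto intro: carrier_vecI)

lemma etf_gabor_steiner: "etf_for N (carrier_vec N) (G \<times> G) \<Psi>"
proof -
  have frame: "frame_operator N (G \<times> G) \<Psi> *\<^sub>v w = (2 * of_nat n) \<cdot>\<^sub>v w"
    if "w \<in> carrier_vec N" for w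
  proof -
    have delta: "c * (if j = i then 1 else 0) * x = (if j = i then c * x else 0)"
      for c x :: complex and i j :: nat by simp
    show ?thesis
      using that unfolding frame_operator_gabor_steiner
      by (intro eq_vecI) (simp_all add: scalar_prod_def delta)
  qed
  have "cspan N (\<Psi> ` (G \<times> G)) = carrier_vec N"
    by (rule cspan_eq_carrierI[OF _ gabor_steiner_carrier _ frame])
      (use pos in \<open>auto simp: in_set_conv_nth\<close>)
  moreover have "\<forall>p\<in>G \<times> G. \<Psi> p \<bullet>c \<Psi> p = of_nat n - 1"
    by (auto simp: inner_same_translation)
  moreover have "cmod (\<Psi> p \<bullet>c \<Psi> q) = 1" if pq: "p \<in> G \<times> G" "q \<in> G \<times> G" "p \<noteq> q" for p q
  proof -
    obtain k \<kappa> l \<mu> where [simp]: "p = (k, \<kappa>)" "q = (l, \<mu>)" by fastforce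
    show ?thesis
    proof (cases "k = l")
      case True
      then show ?thesis using pq by (simp add: inner_same_translation norm_mult)
    next
      case False
      then show ?thesis using pq by (simp add: cmod_inner_different_translation)
    qed
  qed
  ultimately show ?thesis
    unfolding etf_for_def using gabor_steiner_carrier frame by (intro conjI exI ballI impI) auto
qed

lemma is_simplex_fiber:
  assumes k: "k \<in> G"
  shows "is_simplex N (carrier_vec N) (G \<times> G) \<Psi> {(k, \<kappa>) |\<kappa>. \<kappa> \<in> G}"
proof -
  let ?J = "{(k, \<kappa>) |\<kappa>. \<kappa> \<in> G}"
  \<comment> \<open>The inner product of two distinct vectors of the fiber is -u_p times the
    conjugate of u_q, where u_p is the character value at mid + k. Multiplying each vector by the
    conjugate of its u_p turns this into -1.\<close>
  define d :: "nat list \<times> nat list \<Rightarrow> complex" where "d = (\<lambda>p. cnj (\<chi> (snd p) (mid \<boxplus> k)))"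
  define \<psi> where "\<psi> = (\<lambda>p. d p \<cdot>\<^sub>v \<Psi> p)"
  have J: "?J = Pair k ` G" by auto
  have d: "cmod (d p) = 1" for p by (simp add: d_def)
  have gram: "\<psi> p \<bullet>c \<psi> q = (if p = q then of_nat n - 1 else - 1)" if pq: "p \<in> ?J" "q \<in> ?J" for p q
  proof -
    obtain \<kappa> \<mu> where [simp]: "p = (k, \<kappa>)" "q = (k, \<mu>)" and G: "\<kappa> \<in> G" "\<mu> \<in> G" using pq by auto
    let ?x = "\<chi> \<kappa> (mid \<boxplus> k)" and ?y = "\<chi> \<mu> (mid \<boxplus> k)"
    have "\<psi> p \<bullet>c \<psi> q = d p * cnj (d q) * (\<Psi> p \<bullet>c \<Psi> q)"
      unfolding \<psi>_def by (simp add: scalar_prod_def sum_distrib_left mult_ac)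
    also have "\<dots> = cnj ?x * ?y * ((if \<kappa> = \<mu> then of_nat n else 0) - ?x * cnj ?y)"
      using k G by (simp add: d_def inner_same_translation)
    also have "\<dots> = (if \<kappa> = \<mu> then (?x * cnj ?x) * of_nat n else 0) - (?x * cnj ?x) * (?y * cnj ?y)"
      by (simp add: algebra_simps del: char_mult_cnj)
    finally show ?thesis unfolding char_mult_cnj by simp
  qed
  have "\<psi> ` ?J \<subseteq> carrier_vec N" by (auto simp: \<psi>_def intro: carrier_vecI)
  moreover have "finite ?J" "card ?J = n"
    unfolding J by (simp_all add: card_image inj_on_def card_G_elems)
  ultimately interpret simplex: simplex_gram N n ?J \<psi>
    using n_ge gram by unfold_locales auto
  have "switching_equivalent N ?J \<Psi> \<psi>"
    unfolding \<psi>_def by (rule smult_switching_equivalent[OF gabor_steiner_carrier]) (simp add: d)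
  moreover have "\<forall>p\<in>?J. \<forall>q\<in>?J. p \<noteq> q \<longrightarrow> \<psi> p \<bullet>c \<psi> q \<in> \<real> \<and> Re (\<psi> p \<bullet>c \<psi> q) < 0"
    by (simp add: gram)
  moreover have "cdim N (cspan N (\<psi> ` ?J)) + 1 = card ?J"
    using simplex.dim_span_psi \<open>card ?J = n\<close> by simp
  moreover have "?J \<subseteq> G \<times> G" using k by auto
  ultimately show ?thesis
    unfolding is_simplex_def using etf_gabor_steiner simplex.etf_for_span by blast
qed

text \<open>For a point x the row at a coordinate labelled (i, g) is the Fourier row g times a sign,
  if the block contains x. The deleted row is mid + x, the one group label that no block through x
  uses.\<close>

lemma steiner_gabor_steiner:
  "\<exists>\<B> blk F' \<Phi>. is_bibd G \<B> n 2 1 \<and> bij_betw blk {..<N} \<B> \<and>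
     (\<forall>x\<in>G. row_deleted_rescaled (fourier_mat m \<zeta>) (F' x) \<and> steiner_submatrix N blk x (F' x) (\<Phi> x) \<and>
        (\<forall>b<n. col (\<Phi> x) b = \<Psi> (x, G_list m ! b)))"
proof -
  define blk where "blk = block \<circ> coord"
  \<comment> \<open>The position of the deleted row mid + x in the lexicographic
    enumeration.\<close>
  define r where "r x = the_inv_into {..<n} ((!) (G_list m)) (mid \<boxplus> x)" for x
  \<comment> \<open>A remaining row g is translated from \<open>I\<close> (sign 1) or from the
    reflection of \<open>I\<close> (sign -1). So the scalar depends on g and x alone.\<close>
  define u :: "nat list \<Rightarrow> nat \<Rightarrow> complex" where
    "u x b = (if \<exists>i\<in>I. G_list m ! insert_index (r x) b = i \<boxplus> x then 1 else - 1)" for x b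
  define F' where "F' x = mat (n - 1) n
    (\<lambda>(a, b). u x a * fourier_mat m \<zeta> $$ (insert_index (r x) a, b))" for x
  define \<Phi> where "\<Phi> x = mat N n (\<lambda>(a, b). \<Psi> (x, G_list m ! b) $ a)" for x
  have blk: "bij_betw blk {..<N} (block ` (I \<times> G))"
    unfolding blk_def
    by (rule bij_betw_trans[OF bij_betw_coord inj_on_imp_bij_betw[OF inj_on_block]])
  have r: "r x < n" "G_list m ! r x = mid \<boxplus> x" for x
    using bij_betw_G_list[of m] plus_closed[of mid x] unfolding r_def bij_betw_def
    by (auto simp: f_the_inv_into_f dest: the_inv_into_into[OF _ _ subset_refl])
  have F': "row_deleted_rescaled (fourier_mat m \<zeta>) (F' x)" for x
    unfolding row_deleted_rescaled_def
    by (rule exI[of _ "r x"], rule exI[of _ "u x"])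
      (use r(1)[of x] in \<open>auto simp: F'_def u_def fourier_mat_def\<close>)
  have \<Phi>: "col (\<Phi> x) b = \<Psi> (x, G_list m ! b)" if "b < n" for x b
    using that by (intro eq_vecI) (auto simp: \<Phi>_def)
  have st: "steiner_submatrix N blk x (F' x) (\<Phi> x)" if x: "x \<in> G" for x
  proof -
    let ?A = "{a. a < N \<and> x \<in> blk a}"
    \<comment> \<open>A coordinate uses the Fourier row of its group label \<open>a mod n\<close>,
      renumbered after the deletion of row \<open>r x\<close>.\<close>
    define \<sigma> where "\<sigma> a = delete_index (r x) (a mod n)" for a
    have mod: "a mod n < n" "a mod n \<noteq> r x" if "a \<in> ?A" for a
    proof -
      show "a mod n < n" using n_ge by simp
      have "coord a \<in> I \<times> G" "x \<in> block (coord a)" using that coord_in by (auto simp: blk_def)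
      then show "a mod n \<noteq> r x" using not_in_block_mid r(2)[of x] by (auto simp: coord_def)
    qed
    have ins: "insert_index (r x) (\<sigma> a) = a mod n" if "a \<in> ?A" for a
      using mod[OF that] by (simp add: \<sigma>_def insert_delete_index)
    have less: "\<sigma> a < n - 1" if "a \<in> ?A" for a
      using mod[OF that] r(1)[of x] unfolding \<sigma>_def delete_index_def
      by (simp only: split: if_split) linarith
    have "bij_betw \<sigma> ?A {..<n - 1}"
      unfolding bij_betw_def
    proof
      show "inj_on \<sigma> ?A"
      proof (rule inj_onI)
        fix a b assume a: "a \<in> ?A" and b: "b \<in> ?A" and "\<sigma> a = \<sigma> b"
        \<comment> \<open>Equal rows mean equal group labels g; the index i is then determined,
          since only one block with label g contains x.\<close>
        then have eq: "a mod n = b mod n" using ins by metis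
        obtain i g where ig: "coord a = (i, g)" "i \<in> I" "g \<in> G" "x \<in> block (i, g)"
          using a coord_in by (fastforce simp: blk_def)
        moreover obtain j where "coord b = (j, g)" "j \<in> I" "x \<in> block (j, g)"
          using b coord_in eq ig(1) by (fastforce simp: blk_def coord_def)
        moreover have "g \<noteq> mid \<boxplus> x" using ig not_in_block_mid by auto
        ultimately have "coord a = coord b" using ex1_block[OF x] by auto
        then show "a = b" using bij_betw_coord a b by (auto simp: bij_betw_def inj_on_def)
      qed
      show "\<sigma> ` ?A = {..<n - 1}"
      proof
        show "\<sigma> ` ?A \<subseteq> {..<n - 1}" using less by auto
        show "{..<n - 1} \<subseteq> \<sigma> ` ?A"
        proof
          fix b assume "b \<in> {..<n - 1}"
          define q where "q = insert_index (r x) b"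
          have q: "q < n" "q \<noteq> r x"
            using \<open>b \<in> _\<close> by (auto simp: q_def insert_index_def)
          then have "G_list m ! q \<noteq> mid \<boxplus> x"
            using r[of x] nth_eq_iff_index_eq[OF distinct_G_list, of q m "r x"] by simp
          then obtain i where i: "i \<in> I" "x \<in> block (i, G_list m ! q)"
            using ex1_block[OF x nth_G_list[OF q(1)]] by blast
          obtain a where a: "a < N" "coord a = (i, G_list m ! q)"
            using bij_betw_imp_surj_on[OF bij_betw_coord] i(1) nth_G_list[OF q(1)]
            by (metis (no_types, lifting) imageE lessThan_iff mem_Sigma_iff)
          have "a \<in> ?A" using a i by (simp add: blk_def)
          have "a mod n = q"
            using a(2) q(1) n_ge by (simp add: coord_def nth_eq_iff_index_eq)
          then have "\<sigma> a = b" by (simp add: \<sigma>_def q_def)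
          then show "b \<in> \<sigma> ` ?A" using \<open>a \<in> ?A\<close> by blast
        qed
      qed
    qed
    moreover have "row (\<Phi> x) a = (if x \<in> blk a then row (F' x) (\<sigma> a) else 0\<^sub>v n)" if a: "a < N" for a
    proof (rule eq_vecI)
      fix b assume "b < dim_vec (if x \<in> blk a then row (F' x) (\<sigma> a) else 0\<^sub>v n)"
      then have b: "b < n" by (simp add: F'_def split: if_splits)
      obtain i g where ig: "coord a = (i, g)" "i \<in> I" "g \<in> G" using coord_in[OF a] by auto
      have g: "g = G_list m ! (a mod n)" using ig(1) by (simp add: coord_def)
      have \<Phi>ab: "row (\<Phi> x) a $ b = \<chi> (G_list m ! b) g * sign x (i, g)"
        using a b by (simp add: \<Phi>_def gabor_steiner_index ig)
      show "row (\<Phi> x) a $ b = (if x \<in> blk a then row (F' x) (\<sigma> a) else 0\<^sub>v n) $ b"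
      proof (cases "x \<in> blk a")
        case True
        then have A: "a \<in> ?A" and xb: "x \<in> block (i, g)" using a ig by (auto simp: blk_def)
        \<comment> \<open>\<open>I\<close> and its reflection are disjoint, so the test in
          \<open>u\<close>, which asks for any element of \<open>I\<close>, agrees with the test g =
          i + x in \<open>sign\<close>.\<close>
        have "g \<noteq> \<rho> i \<boxplus> x" if "j \<in> I" "g = j \<boxplus> x" for j
          using that I_subset plus_cancel(1)[of j "\<rho> i" x] reflect_I(1,2)[OF ig(2)] by auto
        then have "(\<exists>j\<in>I. g = j \<boxplus> x) \<longleftrightarrow> g = i \<boxplus> x"
          using xb ig(2) unfolding in_block by blast
        then have "u x (\<sigma> a) = sign x (i, g)"
          using sign_cases[of "(i, g)" x] ig x xb by (simp add: u_def ins[OF A] g[symmetric])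
        then show ?thesis
          using True less[OF A] b mod[OF A] \<Phi>ab
          by (simp add: F'_def ins[OF A] fourier_mat_def g[symmetric] G_char_commute[of m \<zeta> g])
      next
        case False
        then show ?thesis
          using b \<Phi>ab sign_cases[of "(i, g)" x] ig x by (simp add: blk_def)
      qed
    qed (simp add: \<Phi>_def F'_def)
    ultimately show ?thesis
      unfolding steiner_submatrix_def by (auto simp: F'_def \<Phi>_def intro!: exI[of _ \<sigma>])
  qed
  show ?thesis
    using is_bibd_blocks blk F' st \<Phi> by blast
qed

end

theorem theorem4p11:
  fixes m :: "nat list" and \<zeta> :: "nat \<Rightarrow> complex" and n N :: nat
  assumes "m \<noteq> []"
    and "\<forall>l<length m. odd (m ! l) \<and> 3 \<le> m ! l"
    and "\<forall>l<length m. primitive_root_of_unity (m ! l) (\<zeta> l)"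
    and "n = prod_list m"
    and "N = n * (n - 1) div 2"
  shows "etf_for N (carrier_vec N) (G_elems m \<times> G_elems m) (gabor_steiner m \<zeta>) \<and>
    (\<forall>k\<in>G_elems m. is_simplex N (carrier_vec N) (G_elems m \<times> G_elems m) (gabor_steiner m \<zeta>)
       {(k, \<kappa>) |\<kappa>. \<kappa> \<in> G_elems m}) \<and>
    (\<exists>\<B> blk F' \<Phi>.
       is_bibd (G_elems m) \<B> n 2 1 \<and> bij_betw blk {..<N} \<B> \<and>
       (\<forall>x\<in>G_elems m.
          row_deleted_rescaled (fourier_mat m \<zeta>) (F' x) \<and>
          steiner_submatrix N blk x (F' x) (\<Phi> x) \<and>
          (\<forall>b<n. col (\<Phi> x) b = gabor_steiner m \<zeta> (x, G_list m ! b))))"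
proof -
  interpret gabor_steiner_system m \<zeta>
    using assms by unfold_locales auto
  \<comment> \<open>The coordinates were counted as |I| n, which is n (n - 1) / 2 because n = 2 |I|
    + 1.\<close>
  have N: "N = odd_moduli.N m"
    using assms(4,5) N_eq by simp
  show ?thesis
    unfolding N assms(4)
    using etf_gabor_steiner is_simplex_fiber steiner_gabor_steiner by blast
qed

end
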